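(* Let $f$ be an entire function, let $R>0$, and let $U$ be a connected component of $A_R=\{z\in\mathbb C:|f(z)|>R\}$ such that the circle $\{z:|z|=r\}$ is not contained in $U$ for all sufficiently large $r$. Let $0<\beta<\tfrac12$, put \[ V=\{z\in U:|f(z)|\ge\exp(|z|^\beta)\},\qquad \psi(r)=\operatorname{meas}\big(\{t\in[0,2\pi]: re^{it}\in V\}\big). \] Then for every $\kappa\in(0,1)$ there exist constants $C$ and $r_0$ such that \[ \log\log M(r,f)\ge \pi\int_{r_0}^{\kappa r}\frac{dt}{t\,\psi(t)}-C\quad\text{for all } r\ge r_0/\kappa . \]
   Context: $M(r,f)=\max_{|z|=r}|f(z)|$; $\operatorname{meas}$ denotes one-dimensional Lebesgue measure. *)

theory Defs
  imports "HOL-Analysis.Analysis"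
begin

definition maxmod :: "(complex \<Rightarrow> complex) \<Rightarrow> real \<Rightarrow> real" where
  "maxmod f r = Sup ((\<lambda>z. norm (f z)) ` sphere 0 r)"

end

theory Submission
  imports Defs "HOL-Complex_Analysis.Cauchy_Integral_Formula"
begin

text \<open>Carleman's method. In the coordinate \<open>z = x + i y\<close> with \<open>exp z \<in> U\<close>, let
  \<open>v = ln \<bar>f (exp z)\<bar> - exp (\<beta> x)\<close> and let \<open>\<phi> x\<close> be the integral of the squared positive part of
  \<open>v\<close> over \<open>0 \<le> y \<le> 2 \<pi>\<close>. Then \<open>\<phi>''\<close> is twice the Dirichlet integral \<open>D\<close> minus an error coming from
  the Laplacian of \<open>v\<close>. Since no large circle lies in \<open>U\<close>, Wirtinger's inequality bounds the
  vertical part of \<open>D\<close> below by \<open>\<mu>\<^sup>2 \<phi>\<close> with \<open>\<mu> = \<pi> / \<psi>\<close>, and then the arithmetic-geometric mean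
  inequality yields \<open>D \<ge> \<mu> \<phi>'\<close>, that is \<open>\<phi>'' \<ge> (2 \<mu> - \<eta>) \<phi>'\<close>. The same argument for a constant
  level in place of \<open>exp (\<beta> x)\<close> has no error term and shows that \<open>\<phi>\<close> grows at least like
  \<open>exp x\<close>; hence \<open>\<eta>\<close> decays like \<open>exp ((\<beta> - 1/2) x)\<close> and is integrable. Integrating the
  inequality bounds \<open>ln \<phi>'\<close> below, and \<open>\<phi>'\<close> is controlled by
  \<open>ln (1/\<kappa>) \<phi>'(x) \<le> \<phi> (x + ln (1/\<kappa>)) \<le> 2 \<pi> (ln M)\<^sup>2\<close>.\<close>

section \<open>Truncated functions on a line\<close>

text \<open>The threshold 1/2 for \<open>\<beta>\<close> is geometric: an arc has length at most
  \<open>2 * pi\<close>, so \<open>\<mu>\<close> may always be taken at least 1/2, and a harmonic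
  \<open>v\<close> then forces \<open>\<phi>\<close> to grow like
  \<open>exp (2 * (1/2) * x)\<close>. The level \<open>exp (\<beta> * x)\<close> has Laplacian
  \<open>\<beta>\<^sup>2 * exp (\<beta> * x)\<close>, which destroys subharmonicity of
  \<open>v\<close>. The resulting error is this Laplacian times the integral of the positive part of
  \<open>v\<close>, hence of order \<open>exp (\<beta> * x)\<close> times the square root of
  \<open>\<phi>\<close>; relative to \<open>\<phi>\<close> it decays exactly when the growth of
  \<open>\<phi>\<close> beats \<open>exp (2 * \<beta> * x)\<close>.

  The factor 2 in front of \<open>\<mu>\<close> is matched by the square in
  \<open>\<phi> \<le> 2 * pi * (ln M)\<^sup>2\<close>: halving the integrated inequality leaves
  \<open>ln (ln M)\<close> against \<open>pi\<close> times the integral of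
  \<open>1 / \<psi>\<close>.

  Differentiating \<open>\<phi>\<close> under the integral sign would require control of the moving
  boundary of the set where \<open>v > 0\<close>. Instead \<open>\<phi>\<close> and
  \<open>\<phi>'\<close> are handled as indefinite integrals, obtained by Fubini from the
  fundamental theorem on single lines, and every differential inequality is used in integrated
  form.\<close>

text \<open>A continuously differentiable approximation of \<open>max 0 s\<close>: the truncated product in
  \<open>has_integral_truncated_product\<close> below need not be differentiable where the factor \<open>f\<close> vanishes,
  and these points may be infinite in number.\<close>

definition smooth_pos :: "real \<Rightarrow> real \<Rightarrow> real" where
  "smooth_pos e s = (if s > 0 then s\<^sup>2 / (s + e) else 0)"

definition smooth_pos' :: "real \<Rightarrow> real \<Rightarrow> real" where
  "smooth_pos' e s = (if s > 0 then (s\<^sup>2 + 2 * s * e) / (s + e)\<^sup>2 else 0)"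

text \<open>At a common zero, domination by a function with vanishing derivative is enough, whatever
  the regularity of \<open>g\<close> elsewhere. This settles the zeros of the truncated
  functions.\<close>

lemma has_field_derivative_zero_dominated:
  fixes f g :: "real \<Rightarrow> real"
  assumes f: "(f has_field_derivative 0) (at x within S)" and fx: "f x = 0" "g x = 0"
    and le: "\<forall>\<^sub>F y in at x within S. \<bar>g y\<bar> \<le> B * \<bar>f y\<bar>"
  shows "(g has_field_derivative 0) (at x within S)"
proof -
  have lim: "((\<lambda>y. f y / (y - x)) \<longlongrightarrow> 0) (at x within S)"
    using f fx by (simp add: has_field_derivative_iff)
  have "((\<lambda>y. B * \<bar>f y / (y - x)\<bar>) \<longlongrightarrow> 0) (at x within S)"
    by (rule tendsto_eq_intros lim | simp)+
  moreover have "\<forall>\<^sub>F y in at x within S. norm (g y / (y - x)) \<le> B * \<bar>f y / (y - x)\<bar>"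
    using le by eventually_elim (auto simp: abs_divide divide_right_mono)
  ultimately have "((\<lambda>y. g y / (y - x)) \<longlongrightarrow> 0) (at x within S)"
    by (rule Lim_null_comparison[rotated])
  then show ?thesis using fx by (simp add: has_field_derivative_iff)
qed

lemma has_field_derivative_smooth_pos:
  assumes e: "e > 0"
  shows "(smooth_pos e has_field_derivative smooth_pos' e s) (at s)"
proof -
  consider "s > 0" | "s < 0" | "s = 0" by linarith
  then show ?thesis
  proof cases
    case 1
    have "((\<lambda>s. s\<^sup>2 / (s + e)) has_field_derivative smooth_pos' e s) (at s)"
      using 1 e by (auto intro!: derivative_eq_intros simp: smooth_pos'_def power2_eq_square algebra_simps)
    then show ?thesis
      by (rule DERIV_cong_ev[THEN iffD1, rotated 3])
        (auto simp: smooth_pos_def intro!: eventually_mono[OF eventually_gt_at_top] eventually_mono[OF order_tendstoD(1)[OF filterlim_ident 1]])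
  next
    case 2
    have "((\<lambda>s. 0) has_field_derivative smooth_pos' e s) (at s)"
      using 2 by (auto simp: smooth_pos'_def)
    then show ?thesis
      by (rule DERIV_cong_ev[THEN iffD1, rotated 3])
        (auto simp: smooth_pos_def intro!: eventually_mono[OF order_tendstoD(2)[OF filterlim_ident 2]])
  next
    case 3
    have "(smooth_pos e has_field_derivative 0) (at 0)"
    proof (rule has_field_derivative_zero_dominated[where f = "\<lambda>s. s\<^sup>2" and B = "1/e"])
      show "((\<lambda>s. s\<^sup>2) has_field_derivative 0) (at (0::real))"
        by (auto intro!: derivative_eq_intros)
      show "\<forall>\<^sub>F y in at 0. \<bar>smooth_pos e y\<bar> \<le> 1 / e * \<bar>y\<^sup>2\<bar>"
        using e by (auto simp: smooth_pos_def frac_le)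
    qed (auto simp: smooth_pos_def)
    then show ?thesis using 3 by (simp add: smooth_pos'_def)
  qed
qed

lemma smooth_pos_le: "e > 0 \<Longrightarrow> 0 \<le> smooth_pos e s" "e > 0 \<Longrightarrow> s > 0 \<Longrightarrow> smooth_pos e s \<le> s"
  by (auto simp: smooth_pos_def divide_simps power2_eq_square)

lemma smooth_pos'_le:
  assumes "e > 0"
  shows "0 \<le> smooth_pos' e s" "smooth_pos' e s \<le> 1"
proof -
  have "s\<^sup>2 + 2 * s * e \<le> (s + e)\<^sup>2" by (simp add: power2_sum)
  then show "0 \<le> smooth_pos' e s" "smooth_pos' e s \<le> 1"
    using assms by (auto simp: smooth_pos'_def divide_le_eq_1)
qed

lemma smooth_pos_tendsto: "((\<lambda>n. smooth_pos (1 / real (Suc n)) s) \<longlongrightarrow> max 0 s) sequentially"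
proof (cases "s > 0")
  case True
  have "((\<lambda>n. s\<^sup>2 / (s + 1 / real (Suc n))) \<longlongrightarrow> s\<^sup>2 / (s + 0)) sequentially"
    using True by (intro tendsto_intros LIMSEQ_Suc[OF lim_1_over_n]) auto
  then show ?thesis using True by (simp add: smooth_pos_def power2_eq_square)
qed (auto simp: smooth_pos_def)

lemma smooth_pos'_tendsto:
  assumes "s > 0"
  shows "((\<lambda>n. smooth_pos' (1 / real (Suc n)) s) \<longlongrightarrow> 1) sequentially"
proof -
  have "((\<lambda>n. (s\<^sup>2 + 2 * s * (1 / real (Suc n))) / (s + 1 / real (Suc n))\<^sup>2) \<longlongrightarrow> (s\<^sup>2 + 2 * s * 0) / (s + 0)\<^sup>2) sequentially"
    using assms by (intro tendsto_intros LIMSEQ_Suc[OF lim_1_over_n]) auto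
  then show ?thesis using assms by (simp add: smooth_pos'_def power2_eq_square)
qed

text \<open>With \<open>smooth_pos e\<close> applied to \<open>f\<close>, the product extended by
  zero is differentiable on the whole interval: \<open>smooth_pos' e\<close> vanishes at the zeros
  of \<open>f\<close>, and \<open>bdry\<close> makes the extension locally zero off
  \<open>w\<close>. Now \<open>e\<close> tends to 0 by dominated convergence, as
  \<open>smooth_pos' e\<close> lies in [0, 1] and \<open>smooth_pos e\<close> stays below the
  identity on positive arguments.\<close>

lemma has_integral_truncated_product:
  fixes f g h h' :: "real \<Rightarrow> real"
  assumes ab: "a \<le> b" and w: "open w"
    and Q: "Q = {x \<in> w. 0 < f x}"
    and deriv: "\<And>x. x \<in> {a..b} \<Longrightarrow> x \<in> w \<Longrightarrow> (f has_field_derivative g x) (at x) \<and> (h has_field_derivative h' x) (at x)"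
    and bdry: "\<And>x. x \<in> {a..b} \<Longrightarrow> x \<notin> w \<Longrightarrow> \<forall>\<^sub>F y in nhds x. y \<notin> Q"
    and bound: "\<And>x. x \<in> {a..b} \<Longrightarrow> x \<in> Q \<Longrightarrow> \<bar>g x * h x\<bar> + \<bar>f x * h' x\<bar> \<le> B"
  shows "((\<lambda>x. if x \<in> Q then g x * h x + f x * h' x else 0) has_integral
      (if b \<in> Q then f b * h b else 0) - (if a \<in> Q then f a * h a else 0)) {a..b}"
proof -
  define e where "e n = 1 / real (Suc n)" for n
  have e: "e n > 0" for n by (simp add: e_def)
  define t where "t n x = (if x \<in> w then smooth_pos (e n) (f x) * h x else 0)" for n x
  define t' where "t' n x = (if x \<in> Q then smooth_pos' (e n) (f x) * g x * h x + smooth_pos (e n) (f x) * h' x else 0)" for n x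
  have dt: "(t n has_field_derivative t' n x) (at x)" if x: "x \<in> {a..b}" for n x
  proof (cases "x \<in> w")
    case True
    have "((\<lambda>x. smooth_pos (e n) (f x) * h x) has_field_derivative
        (smooth_pos' (e n) (f x) * g x) * h x + h' x * smooth_pos (e n) (f x)) (at x)"
      using deriv[OF x True]
      by (intro DERIV_mult DERIV_chain2[OF has_field_derivative_smooth_pos[OF e]]) auto
    also have "(smooth_pos' (e n) (f x) * g x) * h x + h' x * smooth_pos (e n) (f x) = t' n x"
      using True by (auto simp: t'_def Q smooth_pos_def smooth_pos'_def)
    finally show ?thesis
    proof (rule DERIV_cong_ev[THEN iffD1, rotated 3])
      show "\<forall>\<^sub>F x in nhds x. smooth_pos (e n) (f x) * h x = t n x"
        using eventually_nhds_in_open[OF w True] by eventually_elim (auto simp: t_def)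
    qed auto
  next
    case False
    have ev: "\<forall>\<^sub>F y in nhds x. 0 = t n y"
      using bdry[OF x False] by eventually_elim (auto simp: t_def Q smooth_pos_def)
    show ?thesis
      by (rule DERIV_cong_ev[THEN iffD1, OF refl ev refl]) (use False in \<open>auto simp: t'_def Q\<close>)
  qed
  have hi: "(t' n has_integral t n b - t n a) {a..b}" for n
    by (rule fundamental_theorem_of_calculus[OF ab])
      (use dt in \<open>auto simp: has_real_derivative_iff_has_vector_derivative[symmetric] intro: has_field_derivative_at_within\<close>)
  define T where "T x = (if x \<in> Q then g x * h x + f x * h' x else 0)" for x
  have bd: "norm (t' n x) \<le> \<bar>B\<bar>" if x: "x \<in> {a..b}" for n x
  proof (cases "x \<in> Q")
    case True
    have "\<bar>smooth_pos' (e n) (f x) * (g x * h x)\<bar> \<le> 1 * \<bar>g x * h x\<bar>"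
      unfolding abs_mult[of "smooth_pos' (e n) (f x)"]
      using smooth_pos'_le[OF e] by (intro mult_right_mono) auto
    moreover have "\<bar>smooth_pos (e n) (f x) * h' x\<bar> \<le> \<bar>f x * h' x\<bar>"
      unfolding abs_mult
      using smooth_pos_le[OF e, where s = "f x"] True by (intro mult_right_mono) (auto simp: Q)
    ultimately show ?thesis using bound[OF x True] True by (auto simp: t'_def mult.assoc)
  qed (auto simp: t'_def)
  have lim: "(\<lambda>n. t' n x) \<longlonglongrightarrow> T x" for x
  proof (cases "x \<in> Q")
    case True
    then have "(\<lambda>n. smooth_pos' (e n) (f x) * g x * h x + smooth_pos (e n) (f x) * h' x) \<longlonglongrightarrow> 1 * g x * h x + max 0 (f x) * h' x"
      unfolding e_def by (intro tendsto_intros smooth_pos_tendsto smooth_pos'_tendsto) (auto simp: Q)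
    then show ?thesis using True by (simp add: t'_def T_def Q max_def)
  qed (auto simp: t'_def T_def)
  have dc: "T integrable_on {a..b}" "(\<lambda>n. integral {a..b} (t' n)) \<longlonglongrightarrow> integral {a..b} T"
    using dominated_convergence[of t' "{a..b}" "\<lambda>_. \<bar>B\<bar>" T] hi bd lim by (auto simp: integrable_on_def)
  have limt: "(\<lambda>n. t n x) \<longlonglongrightarrow> (if x \<in> Q then f x * h x else 0)" for x
  proof (cases "x \<in> w")
    case True
    then have "(\<lambda>n. smooth_pos (e n) (f x) * h x) \<longlonglongrightarrow> max 0 (f x) * h x"
      unfolding e_def by (intro tendsto_intros smooth_pos_tendsto)
    then show ?thesis using True by (auto simp: t_def Q max_def split: if_splits)
  qed (auto simp: t_def Q)
  have "(\<lambda>n. integral {a..b} (t' n)) \<longlonglongrightarrow> (if b \<in> Q then f b * h b else 0) - (if a \<in> Q then f a * h a else 0)"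
    unfolding integral_unique[OF hi] by (intro tendsto_diff limt)
  then have "integral {a..b} T = (if b \<in> Q then f b * h b else 0) - (if a \<in> Q then f a * h a else 0)"
    using dc(2) LIMSEQ_unique by blast
  with integrable_integral[OF dc(1)] show ?thesis by (simp only: T_def[abs_def])
qed

text \<open>Wirtinger's inequality on the positivity set of \<open>u\<close>, through Picone's identity
  \<open>u'\<^sup>2 - c\<^sup>2 u\<^sup>2 = (u' - Y u)\<^sup>2 + (u\<^sup>2 Y)'\<close> for solutions of \<open>Y' = - (c\<^sup>2 + Y\<^sup>2)\<close>. Taking the
  argument of the cotangent to be the measure of the part of the positivity set already passed lets
  \<open>Y\<close> stay constant on the gaps, so no decomposition into intervals is needed. The offset \<open>q\<close>
  allows the circle to be cut at an arbitrary point.\<close>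

lemma picone_inequality:
  fixes u d :: "real \<Rightarrow> real"
  assumes ab: "a \<le> b" and c: "c > 0"
    and u0: "\<And>x. x \<in> {a..b} \<Longrightarrow> u x \<ge> 0"
    and pos: "\<And>x. x \<in> {a..b} \<Longrightarrow> u x > 0 \<Longrightarrow> (u has_field_derivative d x) (at x)"
    and zero: "\<And>x. x \<in> {a..b} \<Longrightarrow> u x = 0 \<Longrightarrow> ((\<lambda>x. (u x)\<^sup>2) has_field_derivative 0) (at x)"
    and int1: "(\<lambda>x. if u x > 0 then 1 else 0 :: real) integrable_on {a..b}"
    and intd: "(\<lambda>x. if u x > 0 then (d x)\<^sup>2 else 0) integrable_on {a..b}"
    and intu: "(\<lambda>x. (u x)\<^sup>2) integrable_on {a..b}"
    and m: "m = integral {a..b} (\<lambda>x. if u x > 0 then 1 else 0 :: real)"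
    and q: "0 < q" "q + c * m < pi"
  shows "(u b)\<^sup>2 * (c * cot (q + c * m)) - (u a)\<^sup>2 * (c * cot q)
    \<le> integral {a..b} (\<lambda>x. if u x > 0 then (d x)\<^sup>2 else 0) - c\<^sup>2 * integral {a..b} (\<lambda>x. (u x)\<^sup>2)"
proof -
  let ?i = "\<lambda>x. if u x > 0 then 1 else 0 :: real"
  define p where "p x = q + c * integral {a..x} ?i" for x
  define Y where "Y x = c * cot (p x)" for x
  have inti: "?i integrable_on {a..x}" if "x \<in> {a..b}" for x
    using integrable_subinterval_real[OF int1, of a x] that by auto
  \<comment> \<open>Staying strictly between 0 and \<open>pi\<close> keeps the cotangent continuous,
    hence \<open>Y\<close> bounded.\<close>
  have p_bd: "q \<le> p x \<and> p x \<le> q + c * m" if x: "x \<in> {a..b}" for x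
  proof -
    have "0 \<le> integral {a..x} ?i" by (intro integral_nonneg inti x) auto
    moreover have "integral {a..x} ?i \<le> m" unfolding m
      by (intro integral_subset_le inti x int1) (use x in auto)
    ultimately show ?thesis using c by (auto simp: p_def)
  qed
  have sinp: "sin (p x) > 0" if x: "x \<in> {a..b}" for x
    using p_bd[OF x] q by (intro sin_gt_zero) auto
  have contp: "continuous_on {a..b} p"
    unfolding p_def by (intro continuous_intros indefinite_integral_continuous_1 int1)
  have contY: "continuous_on {a..b} Y"
    unfolding Y_def cot_def using contp by (intro continuous_intros) (use sinp in \<open>auto simp: less_imp_neq[symmetric]\<close>)
  obtain B where B: "\<And>x. x \<in> {a..b} \<Longrightarrow> \<bar>Y x\<bar> \<le> B"
    using compact_imp_bounded[OF compact_continuous_image[OF contY compact_Icc]]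
    by (fastforce simp: bounded_iff)
  define T where "T x = (if u x > 0 then 2 * u x * d x * Y x - (u x)\<^sup>2 * (c\<^sup>2 + (Y x)\<^sup>2) else 0)" for x
  have dT: "((\<lambda>x. (u x)\<^sup>2 * Y x) has_field_derivative T x) (at x within {a..b})" if x: "x \<in> {a..b}" for x
  proof (cases "u x > 0")
    case True
    have "isCont u x" using pos[OF x True] DERIV_isCont by blast
    then have evu: "\<forall>\<^sub>F y in at x. u y > 0"
      using True by (auto simp: isCont_def intro: order_tendstoD)
    have "continuous (at x within {a..b}) ?i"
    proof (rule continuous_at_imp_continuous_within)
      have "(?i \<longlongrightarrow> 1) (at x)"
        by (rule tendsto_eventually) (use evu in eventually_elim, auto)
      then show "isCont ?i x" using True by (simp add: isCont_def)
    qed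
    from integral_has_vector_derivative_continuous_at[OF int1, of x "{}"] x this True
    have "((\<lambda>y. integral {a..y} ?i) has_field_derivative 1) (at x within {a..b})"
      by (simp add: has_real_derivative_iff_has_vector_derivative)
    then have dp: "(p has_field_derivative c) (at x within {a..b})"
      unfolding p_def by (auto intro!: derivative_eq_intros)
    have dY: "(Y has_field_derivative - (c\<^sup>2 + (Y x)\<^sup>2)) (at x within {a..b})"
    proof -
      have "sin (p x) \<noteq> 0" using sinp[OF x] by simp
      have "(Y has_field_derivative c * (- inverse ((sin (p x))\<^sup>2) * c)) (at x within {a..b})"
        unfolding Y_def by (intro DERIV_cmult DERIV_chain2[OF DERIV_cot dp]) fact
      also have "c * (- inverse ((sin (p x))\<^sup>2) * c) = - (c\<^sup>2 * ((sin (p x))\<^sup>2 + (cos (p x))\<^sup>2) / (sin (p x))\<^sup>2)"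
        by (simp add: power2_eq_square field_simps)
      also have "\<dots> = - (c\<^sup>2 + (Y x)\<^sup>2)"
        using \<open>sin (p x) \<noteq> 0\<close> unfolding Y_def cot_def
        by (simp add: add_divide_distrib distrib_left power_divide power_mult_distrib
            del: sin_cos_squared_add sin_cos_squared_add2)
      finally show ?thesis .
    qed
    show ?thesis
      by (rule derivative_eq_intros dY has_field_derivative_at_within[OF pos[OF x True]] refl)+
        (use True in \<open>auto simp: T_def algebra_simps\<close>)
  next
    case False
    \<comment> \<open>At a zero of \<open>u\<close> the accumulated measure, and with it
      \<open>Y\<close>, need not be differentiable; a bounded \<open>Y\<close> suffices because the
      square of \<open>u\<close> has derivative 0 there.\<close>
    with u0[OF x] have ux: "u x = 0" by simp
    have "((\<lambda>x. (u x)\<^sup>2 * Y x) has_field_derivative 0) (at x within {a..b})"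
    proof (rule has_field_derivative_zero_dominated[where B = B])
      show "((\<lambda>x. (u x)\<^sup>2) has_field_derivative 0) (at x within {a..b})"
        using zero[OF x ux] by (rule has_field_derivative_at_within)
      show "\<forall>\<^sub>F y in at x within {a..b}. \<bar>(u y)\<^sup>2 * Y y\<bar> \<le> B * \<bar>(u y)\<^sup>2\<bar>"
        unfolding eventually_at_filter
        by (rule always_eventually) (auto simp: abs_mult mult.commute intro!: mult_right_mono B)
    qed (use ux in auto)
    then show ?thesis using ux by (simp add: T_def)
  qed
  have "(T has_integral (u b)\<^sup>2 * Y b - (u a)\<^sup>2 * Y a) {a..b}"
    by (rule fundamental_theorem_of_calculus[OF ab])
      (use dT in \<open>auto simp: has_real_derivative_iff_has_vector_derivative[symmetric]\<close>)
  moreover have "((\<lambda>x. (if u x > 0 then (d x)\<^sup>2 else 0) - c\<^sup>2 * (u x)\<^sup>2) has_integral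
     (integral {a..b} (\<lambda>x. if u x > 0 then (d x)\<^sup>2 else 0) - c\<^sup>2 * integral {a..b} (\<lambda>x. (u x)\<^sup>2))) {a..b}"
    by (intro has_integral_diff has_integral_mult_right integrable_integral intd intu)
  moreover have "T x \<le> (if u x > 0 then (d x)\<^sup>2 else 0) - c\<^sup>2 * (u x)\<^sup>2" if "x \<in> {a..b}" for x
  proof (cases "u x > 0")
    case True
    have "0 \<le> (d x - u x * Y x)\<^sup>2" by simp
    then show ?thesis using True by (simp add: T_def power2_eq_square algebra_simps)
  next
    case False
    with u0[OF that] show ?thesis by (auto simp: T_def)
  qed
  ultimately have "(u b)\<^sup>2 * Y b - (u a)\<^sup>2 * Y a \<le> (integral {a..b} (\<lambda>x. if u x > 0 then (d x)\<^sup>2 else 0) - c\<^sup>2 * integral {a..b} (\<lambda>x. (u x)\<^sup>2))"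
    by (rule has_integral_le)
  then show ?thesis by (simp add: Y_def p_def m)
qed

section \<open>Integration over vertical segments\<close>

text \<open>\<open>W\<close> is a tract in the logarithmic coordinate; since \<open>v < 0\<close> near the boundary of \<open>W\<close> to the
  right of \<open>x0\<close>, extending the positive part of \<open>v\<close> by zero causes no loss of regularity there.\<close>

locale carleman =
  fixes W :: "complex set" and v vx vy vxx vyy :: "complex \<Rightarrow> real" and c :: "real \<Rightarrow> real" and x0 :: real
  assumes open_W: "open W"
    and cont: "continuous_on W v" "continuous_on W vx" "continuous_on W vy"
      "continuous_on W vxx" "continuous_on W vyy"
    and deriv_x: "z \<in> W \<Longrightarrow> ((\<lambda>x. v (Complex x (Im z))) has_field_derivative vx z) (at (Re z))"
    and deriv_y: "z \<in> W \<Longrightarrow> ((\<lambda>y. v (Complex (Re z) y)) has_field_derivative vy z) (at (Im z))"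
    and deriv_xx: "z \<in> W \<Longrightarrow> ((\<lambda>x. vx (Complex x (Im z))) has_field_derivative vxx z) (at (Re z))"
    and deriv_yy: "z \<in> W \<Longrightarrow> ((\<lambda>y. vy (Complex (Re z) y)) has_field_derivative vyy z) (at (Im z))"
    and laplacian: "z \<in> W \<Longrightarrow> vxx z + vyy z = - c (Re z)"
    and boundary: "x0 < Re z \<Longrightarrow> z \<notin> W \<Longrightarrow> \<forall>\<^sub>F w in nhds z. w \<notin> W \<or> v w < 0"
    and periodic: "Complex x (2 * pi) \<in> W \<longleftrightarrow> Complex x 0 \<in> W"
      "v (Complex x (2 * pi)) = v (Complex x 0)" "vy (Complex x (2 * pi)) = vy (Complex x 0)"
begin

definition P :: "complex set" where "P = {z \<in> W. 0 < v z}"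

definition tr :: "(complex \<Rightarrow> real) \<Rightarrow> complex \<Rightarrow> real" where
  "tr g z = (if z \<in> P then g z else 0)"

definition I :: "(complex \<Rightarrow> real) \<Rightarrow> real \<Rightarrow> real" where
  "I g x = (LINT y:{0..2*pi}|lborel. tr g (Complex x y))"

lemma P_subset: "P \<subseteq> W" by (auto simp: P_def)

lemma open_P: "open P"
  unfolding P_def using continuous_openin_preimage_gen[OF cont(1), of "{0<..}"]
    openin_open_eq[OF open_W] by (auto simp: vimage_def Int_def)

lemma tr_measurable [measurable]:
  assumes "continuous_on W g"
  shows "tr g \<in> borel_measurable borel"
proof -
  have "(\<lambda>z. indicator P z *\<^sub>R g z) \<in> borel_measurable borel"
    using open_P assms P_subset
    by (intro borel_measurable_continuous_on_indicator) (auto intro: continuous_on_subset)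
  also have "(\<lambda>z. indicator P z *\<^sub>R g z) = tr g" by (auto simp: tr_def indicator_def)
  finally show ?thesis .
qed

lemma Complex_measurable [measurable]:
  "(\<lambda>p. Complex (fst p) (snd p)) \<in> borel_measurable (borel \<Otimes>\<^sub>M borel)"
  "(\<lambda>y. Complex x y) \<in> borel_measurable borel"
  unfolding Complex_eq by measurable

text \<open>By \<open>boundary\<close> the set where \<open>v\<close> is nonnegative stays away from
  the boundary of \<open>W\<close>, so it is closed although \<open>W\<close> is open. This bounds
  every continuous function on \<open>W\<close> over the part that matters.\<close>

lemma compact_nonneg_part:
  assumes "x0 < a"
  shows "compact {z \<in> cbox (Complex a 0) (Complex b (2*pi)). z \<in> W \<and> 0 \<le> v z}" (is "compact ?C")
proof -
  have "open (- ?C)"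
  unfolding open_subopen[of "- ?C"]
  proof (intro ballI)
    fix z assume z: "z \<in> - ?C"
    have "\<forall>\<^sub>F w in nhds z. w \<in> - ?C"
    proof (cases "z \<in> cbox (Complex a 0) (Complex b (2*pi))")
      case False
      have "open (- cbox (Complex a 0) (Complex b (2*pi)))" by (rule open_Compl[OF closed_cbox])
      from eventually_nhds_in_open[OF this, of z] False
      show ?thesis by (auto elim: eventually_mono)
    next
      case True
      then have re: "x0 < Re z" using assms by (auto simp: in_cbox_complex_iff)
      show ?thesis
      proof (cases "z \<in> W")
        case True
        with z re \<open>z \<in> cbox _ _\<close> have "v z < 0" by auto
        have "isCont v z" using cont(1) open_W True continuous_on_eq_continuous_at by blast
        then have "(v \<longlongrightarrow> v z) (nhds z)" by (simp add: continuous_at tendsto_nhds_iff)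
        from order_tendstoD(2)[OF this \<open>v z < 0\<close>] show ?thesis by (auto elim: eventually_mono)
      next
        case False
        from boundary[OF re this] show ?thesis by (auto elim: eventually_mono)
      qed
    qed
    then show "\<exists>T. open T \<and> z \<in> T \<and> T \<subseteq> - ?C" unfolding eventually_nhds by blast
  qed
  then have "closed ?C" by (simp add: closed_def)
  moreover have "bounded ?C" by (rule bounded_subset[OF bounded_cbox]) auto
  ultimately show ?thesis by (simp add: compact_eq_bounded_closed)
qed

lemma tr_bounded:
  assumes "x0 < a" "continuous_on W g"
  obtains B where "\<And>x y. x \<in> {a..b} \<Longrightarrow> y \<in> {0..2*pi} \<Longrightarrow> \<bar>tr g (Complex x y)\<bar> \<le> B"
proof -
  let ?C = "{z \<in> cbox (Complex a 0) (Complex b (2*pi)). z \<in> W \<and> 0 \<le> v z}"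
  have "continuous_on ?C g" by (rule continuous_on_subset[OF assms(2)]) auto
  from compact_imp_bounded[OF compact_continuous_image[OF this compact_nonneg_part[OF assms(1)]]]
  obtain B where B: "\<And>z. z \<in> ?C \<Longrightarrow> \<bar>g z\<bar> \<le> B" by (fastforce simp: bounded_iff)
  have "\<bar>tr g (Complex x y)\<bar> \<le> \<bar>B\<bar>" if "x \<in> {a..b}" "y \<in> {0..2*pi}" for x y
    using B[of "Complex x y"] that by (auto simp: tr_def P_def in_cbox_complex_iff)
  then show ?thesis using that by blast
qed

lemma tr_set_integrable:
  assumes "x0 < x" "continuous_on W g"
  shows "set_integrable lborel {0..2*pi} (\<lambda>y. tr g (Complex x y))"
proof -
  obtain B where B: "\<And>x' y. x' \<in> {x..x} \<Longrightarrow> y \<in> {0..2*pi} \<Longrightarrow> \<bar>tr g (Complex x' y)\<bar> \<le> B"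
    using tr_bounded[OF assms] by blast
  note [measurable] = tr_measurable[OF assms(2)]
  show ?thesis unfolding set_integrable_def
    by (rule integrableI_bounded_set_indicator[where B = B]) (use B in auto)
qed

lemma I_eq_integral:
  assumes "x0 < x" "continuous_on W g"
  shows "(\<lambda>y. tr g (Complex x y)) integrable_on {0..2*pi}"
    "I g x = integral {0..2*pi} (\<lambda>y. tr g (Complex x y))"
  using set_borel_integral_eq_integral[OF tr_set_integrable[OF assms]] by (auto simp: I_def)

lemma I_add:
  assumes "x0 < x" "continuous_on W g" "continuous_on W h"
  shows "I (\<lambda>z. g z + h z) x = I g x + I h x"
proof -
  have "tr (\<lambda>z. g z + h z) z = tr g z + tr h z" for z by (simp add: tr_def)
  then show ?thesis unfolding I_def using assms by (simp add: set_integral_add tr_set_integrable)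
qed

lemma I_mult: "I (\<lambda>z. r * g z) x = r * I g x"
proof -
  have "tr (\<lambda>z. r * g z) z = r * tr g z" for z by (simp add: tr_def)
  then show ?thesis unfolding I_def by simp
qed

lemma I_cong: "(\<And>z. z \<in> P \<Longrightarrow> Re z = x \<Longrightarrow> g z = h z) \<Longrightarrow> I g x = I h x"
  unfolding I_def by (rule arg_cong[where f = "\<lambda>f. set_lebesgue_integral lborel _ f"]) (auto simp: tr_def)

lemma I_mono:
  assumes "x0 < x" "continuous_on W g" "continuous_on W h" "\<And>z. z \<in> P \<Longrightarrow> Re z = x \<Longrightarrow> g z \<le> h z"
  shows "I g x \<le> I h x"
  unfolding I_def using assms
  by (intro set_integral_mono tr_set_integrable) (auto simp: tr_def)

lemma I_nonneg:
  assumes "\<And>z. z \<in> P \<Longrightarrow> Re z = x \<Longrightarrow> 0 \<le> g z"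
  shows "0 \<le> I g x"
  unfolding I_def set_lebesgue_integral_def using assms
  by (intro integral_nonneg_AE AE_I2) (auto simp: tr_def)

lemma I_one_le:
  assumes "x0 < x"
  shows "I (\<lambda>_. 1) x \<le> 2 * pi"
proof -
  have "I (\<lambda>_. 1) x \<le> (LINT y:{0..2*pi}|lborel. 1)"
    unfolding I_def using assms
    by (intro set_integral_mono tr_set_integrable) (auto simp: tr_def set_integrable_def)
  then show ?thesis by (simp add: set_lebesgue_integral_def)
qed

text \<open>Exchanging the order of integration carries the fundamental theorem from each horizontal
  line over to the vertical integrals, without differentiating under the integral sign.\<close>

lemma I_fubini:
  assumes a: "x0 < a" "a \<le> b" and g: "continuous_on W g" and h: "continuous_on W h"
    and hi: "\<And>y. y \<in> {0..2*pi} \<Longrightarrow>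
      ((\<lambda>x. tr g (Complex x y)) has_integral tr h (Complex b y) - tr h (Complex a y)) {a..b}"
  shows "set_integrable lborel {a..b} (I g)"
    "(LINT x:{a..b}|lborel. I g x) = I h b - I h a"
proof -
  note [measurable] = tr_measurable[OF g] tr_measurable[OF h]
  let ?f = "\<lambda>x y. indicator {a..b} x * (indicator {0..2*pi} y * tr g (Complex x y))"
  obtain B where B: "\<And>x y. x \<in> {a..b} \<Longrightarrow> y \<in> {0..2*pi} \<Longrightarrow> \<bar>tr g (Complex x y)\<bar> \<le> B"
    using tr_bounded[OF a(1) g] by blast
  have "integrable (lborel \<Otimes>\<^sub>M lborel) (\<lambda>p. indicator ({a..b} \<times> {0..2*pi}) p *\<^sub>R tr g (Complex (fst p) (snd p)))"
  proof (rule integrableI_bounded_set_indicator[where B = B])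
    show "emeasure (lborel \<Otimes>\<^sub>M lborel) ({a..b} \<times> {0..2 * pi}) < \<infinity>"
      by (subst lborel.emeasure_pair_measure_Times) (auto simp: ennreal_mult_less_top a)
  qed (use B in auto)
  also have "(\<lambda>p. indicator ({a..b} \<times> {0..2*pi}) p *\<^sub>R tr g (Complex (fst p) (snd p))) = case_prod ?f"
    by (auto simp: indicator_def fun_eq_iff)
  finally have int: "integrable (lborel \<Otimes>\<^sub>M lborel) (case_prod ?f)" .
  have fst: "(\<integral>y. ?f x y \<partial>lborel) = indicator {a..b} x *\<^sub>R I g x" for x
    by (simp add: I_def set_lebesgue_integral_def)
  show "set_integrable lborel {a..b} (I g)"
    unfolding set_integrable_def using lborel_pair.integrable_fst'[OF int]
    by (simp only: fst case_prod_conv)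
  have snd: "(\<integral>x. ?f x y \<partial>lborel) = indicator {0..2*pi} y * (tr h (Complex b y) - tr h (Complex a y))" for y
  proof (cases "y \<in> {0..2*pi}")
    case True
    have m: "(\<lambda>x. Complex x y) \<in> borel_measurable borel" unfolding Complex_eq by measurable
    have "set_integrable lborel {a..b} (\<lambda>x. tr g (Complex x y))"
      unfolding set_integrable_def
      by (rule integrableI_bounded_set_indicator[where B = B]) (use B True m a in auto)
    from set_borel_integral_eq_integral(2)[OF this] hi[OF True]
    have "(LINT x:{a..b}|lborel. tr g (Complex x y)) = tr h (Complex b y) - tr h (Complex a y)"
      by (simp add: integral_unique)
    then show ?thesis using True by (simp add: set_lebesgue_integral_def)
  qed auto
  have "(LINT x:{a..b}|lborel. I g x) = (\<integral>x. \<integral>y. ?f x y \<partial>lborel \<partial>lborel)"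
    by (simp only: fst set_lebesgue_integral_def)
  also have "\<dots> = (\<integral>y. \<integral>x. ?f x y \<partial>lborel \<partial>lborel)"
    by (rule lborel_pair.Fubini_integral[OF int, symmetric])
  also have "\<dots> = (LINT y:{0..2*pi}|lborel. tr h (Complex b y) - tr h (Complex a y))"
    by (simp only: snd set_lebesgue_integral_def real_scaleR_def)
  also have "\<dots> = I h b - I h a"
    unfolding I_def using a g h by (intro set_integral_diff tr_set_integrable) auto
  finally show "(LINT x:{a..b}|lborel. I g x) = I h b - I h a" .
qed

text \<open>The factor \<open>v\<close> vanishes where a horizontal line leaves \<open>P\<close>, so
  no boundary terms arise. The cases \<open>h = v\<close> and \<open>h = 2 * vx\<close> yield the
  increments of \<open>\<phi>\<close> and \<open>\<phi>'\<close>.\<close>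

lemma I_fundamental:
  assumes a: "x0 < a" "a \<le> b" and h: "continuous_on W h" "continuous_on W h'"
    and dh: "\<And>z. z \<in> W \<Longrightarrow> ((\<lambda>x. h (Complex x (Im z))) has_field_derivative h' z) (at (Re z))"
  shows "set_integrable lborel {a..b} (I (\<lambda>z. vx z * h z + v z * h' z))"
    "(LINT x:{a..b}|lborel. I (\<lambda>z. vx z * h z + v z * h' z) x) = I (\<lambda>z. v z * h z) b - I (\<lambda>z. v z * h z) a"
proof -
  have hi: "((\<lambda>x. tr (\<lambda>z. vx z * h z + v z * h' z) (Complex x y)) has_integral
      tr (\<lambda>z. v z * h z) (Complex b y) - tr (\<lambda>z. v z * h z) (Complex a y)) {a..b}"
    if y: "y \<in> {0..2*pi}" for y
  proof -
    have ct: "isCont (\<lambda>x. Complex x y) x" for x unfolding Complex_eq by (intro continuous_intros)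
    have "continuous_on W (\<lambda>z. \<bar>vx z * h z\<bar> + \<bar>v z * h' z\<bar>)" by (intro continuous_intros cont h)
    then obtain B where B: "\<And>x y. x \<in> {a..b} \<Longrightarrow> y \<in> {0..2*pi} \<Longrightarrow> \<bar>tr (\<lambda>z. \<bar>vx z * h z\<bar> + \<bar>v z * h' z\<bar>) (Complex x y)\<bar> \<le> B"
      using tr_bounded[OF a(1)] by blast
    let ?w = "{x. Complex x y \<in> W}"
    let ?Q = "{x \<in> ?w. 0 < v (Complex x y)}"
    have "((\<lambda>x. if x \<in> ?Q then vx (Complex x y) * h (Complex x y) + v (Complex x y) * h' (Complex x y) else 0) has_integral
      (if b \<in> ?Q then v (Complex b y) * h (Complex b y) else 0) - (if a \<in> ?Q then v (Complex a y) * h (Complex a y) else 0)) {a..b}"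
    proof (rule has_integral_truncated_product[OF a(2) _ refl])
      show "open ?w"
        using continuous_open_preimage[OF continuous_at_imp_continuous_on open_UNIV open_W, of "\<lambda>x. Complex x y"] ct
        by (simp add: vimage_def)
    next
      fix x assume "x \<in> {a..b}" "x \<in> ?w"
      then show "((\<lambda>x. v (Complex x y)) has_real_derivative vx (Complex x y)) (at x) \<and>
            ((\<lambda>x. h (Complex x y)) has_real_derivative h' (Complex x y)) (at x)"
        using deriv_x[of "Complex x y"] dh[of "Complex x y"] by simp
    next
      fix x assume x: "x \<in> {a..b}" "x \<notin> ?w"
      have "filterlim (\<lambda>x. Complex x y) (nhds (Complex x y)) (nhds x)"
        using ct[of x] by (simp add: continuous_at tendsto_nhds_iff)
      moreover have "\<forall>\<^sub>F w in nhds (Complex x y). w \<notin> W \<or> v w < 0"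
        using boundary[of "Complex x y"] x a by auto
      ultimately have "\<forall>\<^sub>F x in nhds x. Complex x y \<notin> W \<or> v (Complex x y) < 0"
        by (rule eventually_compose_filterlim[rotated])
      then show "\<forall>\<^sub>F x in nhds x. x \<notin> ?Q" by eventually_elim auto
    next
      fix x assume "x \<in> {a..b}" "x \<in> ?Q"
      then show "\<bar>vx (Complex x y) * h (Complex x y)\<bar> + \<bar>v (Complex x y) * h' (Complex x y)\<bar> \<le> B"
        using B[of x y] y by (simp add: tr_def P_def)
    qed
    then show ?thesis by (simp add: tr_def P_def)
  qed
  have "continuous_on W (\<lambda>z. vx z * h z + v z * h' z)" "continuous_on W (\<lambda>z. v z * h z)"
    by (intro continuous_intros cont h)+
  from I_fubini[OF a this hi]
  show "set_integrable lborel {a..b} (I (\<lambda>z. vx z * h z + v z * h' z))"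
    "(LINT x:{a..b}|lborel. I (\<lambda>z. vx z * h z + v z * h' z) x) = I (\<lambda>z. v z * h z) b - I (\<lambda>z. v z * h z) a"
    by auto
qed

text \<open>Integration by parts around the circle: the integrand is the \<open>y\<close>-derivative
  of \<open>v * vy\<close>, whose values at 0 and \<open>2 * pi\<close> cancel by periodicity, while
  \<open>v\<close> vanishes at the other ends of the arcs.\<close>

lemma I_vertical:
  assumes x: "x0 < x"
  shows "I (\<lambda>z. vy z * vy z + v z * vyy z) x = 0"
proof -
  have ct: "isCont (\<lambda>y. Complex x y) y" for y unfolding Complex_eq by (intro continuous_intros)
  have "continuous_on W (\<lambda>z. \<bar>vy z * vy z\<bar> + \<bar>v z * vyy z\<bar>)" by (intro continuous_intros cont)
  then obtain B where B: "\<And>x' y. x' \<in> {x..x} \<Longrightarrow> y \<in> {0..2*pi} \<Longrightarrow> \<bar>tr (\<lambda>z. \<bar>vy z * vy z\<bar> + \<bar>v z * vyy z\<bar>) (Complex x' y)\<bar> \<le> B"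
    using tr_bounded[OF x] by blast
  let ?w = "{y. Complex x y \<in> W}"
  let ?Q = "{y \<in> ?w. 0 < v (Complex x y)}"
  have "((\<lambda>y. if y \<in> ?Q then vy (Complex x y) * vy (Complex x y) + v (Complex x y) * vyy (Complex x y) else 0) has_integral
      (if 2*pi \<in> ?Q then v (Complex x (2*pi)) * vy (Complex x (2*pi)) else 0) - (if 0 \<in> ?Q then v (Complex x 0) * vy (Complex x 0) else 0)) {0..2*pi}"
  proof (rule has_integral_truncated_product[OF _ _ refl])
    show "open ?w"
      using continuous_open_preimage[OF continuous_at_imp_continuous_on open_UNIV open_W, of "\<lambda>y. Complex x y"] ct
      by (simp add: vimage_def)
  next
    fix y assume "y \<in> {0..2*pi}" "y \<in> ?w"
    then show "((\<lambda>y. v (Complex x y)) has_real_derivative vy (Complex x y)) (at y) \<and>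
          ((\<lambda>y. vy (Complex x y)) has_real_derivative vyy (Complex x y)) (at y)"
      using deriv_y[of "Complex x y"] deriv_yy[of "Complex x y"] by simp
  next
    fix y assume y: "y \<in> {0..2*pi}" "y \<notin> ?w"
    have "filterlim (\<lambda>y. Complex x y) (nhds (Complex x y)) (nhds y)"
      using ct[of y] by (simp add: continuous_at tendsto_nhds_iff)
    moreover have "\<forall>\<^sub>F w in nhds (Complex x y). w \<notin> W \<or> v w < 0"
      using boundary[of "Complex x y"] x y by auto
    ultimately have "\<forall>\<^sub>F y in nhds y. Complex x y \<notin> W \<or> v (Complex x y) < 0"
      by (rule eventually_compose_filterlim[rotated])
    then show "\<forall>\<^sub>F y in nhds y. y \<notin> ?Q" by eventually_elim auto
  next
    fix y assume "y \<in> {0..2*pi}" "y \<in> ?Q"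
    then show "\<bar>vy (Complex x y) * vy (Complex x y)\<bar> + \<bar>v (Complex x y) * vyy (Complex x y)\<bar> \<le> B"
      using B[of x y] by (simp add: tr_def P_def)
  qed auto
  then have "((\<lambda>y. tr (\<lambda>z. vy z * vy z + v z * vyy z) (Complex x y)) has_integral 0) {0..2*pi}"
    by (simp add: tr_def P_def periodic cong: if_cong)
  moreover have "continuous_on W (\<lambda>z. vy z * vy z + v z * vyy z)" by (intro continuous_intros cont)
  ultimately show ?thesis using I_eq_integral(2)[OF x] by (simp add: integral_unique)
qed

end

section \<open>The differential inequality\<close>

context carleman begin

text \<open>These are the hypotheses of \<open>picone_inequality\<close>. At a zero of the
  truncation, either \<open>v = 0\<close> inside \<open>W\<close>, and the square of
  \<open>v\<close> dominates, or the truncation vanishes in a neighbourhood.\<close>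

lemma tr_truncation_deriv:
  assumes x: "x0 < x"
  shows "tr v (Complex x y) > 0 \<Longrightarrow> ((\<lambda>y. tr v (Complex x y)) has_field_derivative vy (Complex x y)) (at y)"
    and "tr v (Complex x y) = 0 \<Longrightarrow> ((\<lambda>y. (tr v (Complex x y))\<^sup>2) has_field_derivative 0) (at y)"
proof -
  have lim: "filterlim (\<lambda>y. Complex x y) (nhds (Complex x y)) (nhds y)"
  proof -
    have "isCont (\<lambda>y. Complex x y) y" unfolding Complex_eq by (intro continuous_intros)
    then show ?thesis by (simp add: continuous_at tendsto_nhds_iff)
  qed
  show "((\<lambda>y. tr v (Complex x y)) has_field_derivative vy (Complex x y)) (at y)" if "tr v (Complex x y) > 0"
  proof -
    have P: "Complex x y \<in> P" using that by (auto simp: tr_def split: if_splits)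
    have "\<forall>\<^sub>F y in nhds y. Complex x y \<in> P"
      by (rule eventually_compose_filterlim[OF eventually_nhds_in_open[OF open_P P] lim])
    then have ev: "\<forall>\<^sub>F y in nhds y. v (Complex x y) = tr v (Complex x y)"
      by eventually_elim (simp add: tr_def)
    show ?thesis
      by (rule DERIV_cong_ev[THEN iffD1, OF refl ev refl])
        (use deriv_y[of "Complex x y"] P P_subset in auto)
  qed
  show "((\<lambda>y. (tr v (Complex x y))\<^sup>2) has_field_derivative 0) (at y)" if "tr v (Complex x y) = 0"
  proof -
    have nP: "Complex x y \<notin> P" using that by (auto simp: tr_def P_def split: if_splits)
    show ?thesis
    proof (cases "Complex x y \<in> W \<and> v (Complex x y) = 0")
      case True
      show ?thesis
      proof (rule has_field_derivative_zero_dominated[where f = "\<lambda>y. (v (Complex x y))\<^sup>2" and B = 1])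
        show "((\<lambda>y. (v (Complex x y))\<^sup>2) has_real_derivative 0) (at y)"
          using deriv_y[of "Complex x y"] True by (auto intro!: derivative_eq_intros)
      qed (use True that in \<open>auto simp: tr_def\<close>)
    next
      case False
      have "\<forall>\<^sub>F w in nhds (Complex x y). w \<notin> W \<or> v w < 0"
      proof (cases "Complex x y \<in> W")
        case True
        with False nP have "v (Complex x y) < 0" by (auto simp: P_def)
        moreover have "(v \<longlongrightarrow> v (Complex x y)) (nhds (Complex x y))"
          using cont(1) open_W True continuous_on_eq_continuous_at[OF open_W]
          by (auto simp: continuous_at tendsto_nhds_iff)
        ultimately show ?thesis using order_tendstoD(2) by (fastforce elim: eventually_mono)
      qed (use boundary[of "Complex x y"] x in auto)
      from eventually_compose_filterlim[OF this lim]
      have ev: "\<forall>\<^sub>F y in nhds y. 0 = (tr v (Complex x y))\<^sup>2"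
        by eventually_elim (auto simp: tr_def P_def)
      show ?thesis by (rule DERIV_cong_ev[THEN iffD1, OF refl ev refl]) simp
    qed
  qed
qed

text \<open>The circle is cut at \<open>t\<close>, where the truncation vanishes, and traversed from
  \<open>t\<close> to \<open>2 * pi\<close> and then from 0 to \<open>t\<close>. Picone's inequality
  is applied to both stretches with a constant \<open>c < \<mu>\<close>.\<close>

lemma I_wirtinger:
  assumes x: "x0 < x" and t: "t \<in> {0..2*pi}" "Complex x t \<notin> P"
    and mu: "0 < \<mu>" "\<mu> * I (\<lambda>_. 1) x \<le> pi"
  shows "\<mu>\<^sup>2 * I (\<lambda>z. v z * v z) x \<le> I (\<lambda>z. vy z * vy z) x"
proof -
  define u where "u y = tr v (Complex x y)" for y
  let ?d = "\<lambda>y. vy (Complex x y)"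
  let ?S = "{0..2*pi}"
  have e1: "tr (\<lambda>_. 1) (Complex x y) = (if u y > 0 then 1 else 0)" for y
    by (auto simp: tr_def P_def u_def)
  have e2: "tr (\<lambda>z. vy z * vy z) (Complex x y) = (if u y > 0 then (?d y)\<^sup>2 else 0)" for y
    by (auto simp: tr_def P_def u_def power2_eq_square)
  have e3: "tr (\<lambda>z. v z * v z) (Complex x y) = (u y)\<^sup>2" for y
    by (auto simp: tr_def u_def power2_eq_square)
  have i1: "(\<lambda>y. if u y > 0 then 1 else 0 :: real) integrable_on ?S"
      "I (\<lambda>_. 1) x = integral ?S (\<lambda>y. if u y > 0 then 1 else 0 :: real)"
    using I_eq_integral[OF x, of "\<lambda>_. 1"] by (simp_all add: e1)
  have i2: "(\<lambda>y. if u y > 0 then (?d y)\<^sup>2 else 0) integrable_on ?S"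
      "I (\<lambda>z. vy z * vy z) x = integral ?S (\<lambda>y. if u y > 0 then (?d y)\<^sup>2 else 0)"
    using I_eq_integral[OF x continuous_on_mult[OF cont(3) cont(3)]] by (simp_all add: e2)
  have i3: "(\<lambda>y. (u y)\<^sup>2) integrable_on ?S"
      "I (\<lambda>z. v z * v z) x = integral ?S (\<lambda>y. (u y)\<^sup>2)"
    using I_eq_integral[OF x continuous_on_mult[OF cont(1) cont(1)]] by (simp_all add: e3)
  note sub = integrable_subinterval_real[where a = 0 and b = "2*pi"]
  note comb = Henstock_Kurzweil_Integration.integral_combine[where a = 0 and c = t and b = "2*pi", symmetric]
  have u_nonneg: "u y \<ge> 0" for y by (auto simp: u_def tr_def P_def)
  have ut: "u t = 0" using t by (simp add: u_def tr_def)
  have uper: "u (2*pi) = u 0" by (simp add: u_def tr_def P_def periodic)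
  have *: "c\<^sup>2 * I (\<lambda>z. v z * v z) x \<le> I (\<lambda>z. vy z * vy z) x" if c: "0 < c" "c < \<mu>" for c
  proof -
    define m1 where "m1 = integral {0..t} (\<lambda>y. if u y > 0 then 1 else 0 :: real)"
    define m2 where "m2 = integral {t..2*pi} (\<lambda>y. if u y > 0 then 1 else 0 :: real)"
    have m: "I (\<lambda>_. 1) x = m1 + m2"
      unfolding m1_def m2_def i1(2) using t by (intro comb i1) auto
    have m0: "m1 \<ge> 0" "m2 \<ge> 0" unfolding m1_def m2_def using t
      by (auto intro!: integral_nonneg sub[OF i1(1)])
    have cm: "c * (m1 + m2) < pi"
    proof (cases "m1 + m2 = 0")
      case False
      then have "c * (m1 + m2) < \<mu> * (m1 + m2)" using m0 c by (intro mult_strict_right_mono) auto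
      then show ?thesis using mu m by simp
    qed auto
    \<comment> \<open>Half of the slack left by \<open>c < \<mu>\<close>, so that the argument of
      the cotangent stays strictly inside (0, \<open>pi\<close>) on the whole tour.\<close>
    define q where "q = (pi - c * (m1 + m2)) / 2"
    have q: "0 < q" "q + c * (m1 + m2) < pi" using cm by (auto simp: q_def field_simps)
    have cm0: "0 \<le> c * m1" "0 \<le> c * m2" using c m0 by auto
    have "(u (2*pi))\<^sup>2 * (c * cot (q + c * m2)) - (u t)\<^sup>2 * (c * cot q)
      \<le> integral {t..2*pi} (\<lambda>x. if u x > 0 then (?d x)\<^sup>2 else 0) - c\<^sup>2 * integral {t..2*pi} (\<lambda>x. (u x)\<^sup>2)"
      by (rule picone_inequality)
        (use t c q cm0 tr_truncation_deriv[OF x] u_nonneg m2_def sub[OF i1(1)] sub[OF i2(1)] sub[OF i3(1)]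
          in \<open>auto simp: u_def algebra_simps\<close>)
    \<comment> \<open>The offset continues from the value reached at \<open>2 * pi\<close>, so the
      boundary terms at \<open>2 * pi\<close> and 0 cancel when the two estimates are added; those
      at \<open>t\<close> are zero.\<close>
    moreover have "(u t)\<^sup>2 * (c * cot ((q + c * m2) + c * m1)) - (u 0)\<^sup>2 * (c * cot (q + c * m2))
      \<le> integral {0..t} (\<lambda>x. if u x > 0 then (?d x)\<^sup>2 else 0) - c\<^sup>2 * integral {0..t} (\<lambda>x. (u x)\<^sup>2)"
      by (rule picone_inequality)
        (use t c q cm0 tr_truncation_deriv[OF x] u_nonneg m1_def sub[OF i1(1)] sub[OF i2(1)] sub[OF i3(1)]
          in \<open>auto simp: u_def algebra_simps\<close>)
    moreover have "I (\<lambda>z. vy z * vy z) x = integral {0..t} (\<lambda>x. if u x > 0 then (?d x)\<^sup>2 else 0) + integral {t..2*pi} (\<lambda>x. if u x > 0 then (?d x)\<^sup>2 else 0)"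
      unfolding i2(2) using t by (intro comb i2) auto
    moreover have "I (\<lambda>z. v z * v z) x = integral {0..t} (\<lambda>x. (u x)\<^sup>2) + integral {t..2*pi} (\<lambda>x. (u x)\<^sup>2)"
      unfolding i3(2) using t by (intro comb i3) auto
    ultimately show ?thesis unfolding ut uper by (simp add: algebra_simps)
  qed
  have "((\<lambda>c. c\<^sup>2 * I (\<lambda>z. v z * v z) x) \<longlongrightarrow> \<mu>\<^sup>2 * I (\<lambda>z. v z * v z) x) (at_left \<mu>)"
    by (intro tendsto_intros)
  then show ?thesis
  proof (rule tendsto_upperbound)
    show "\<forall>\<^sub>F c in at_left \<mu>. c\<^sup>2 * I (\<lambda>z. v z * v z) x \<le> I (\<lambda>z. vy z * vy z) x"
      using eventually_at_left_real[OF mu(1)] by eventually_elim (use * in auto)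
  qed auto
qed

text \<open>The primes are formal: only the integrand is differentiated. What is proved is that
  \<open>\<phi>'\<close> and \<open>\<phi>''\<close> integrate to the increments of
  \<open>\<phi>\<close> and \<open>\<phi>'\<close>.\<close>

definition \<phi> :: "real \<Rightarrow> real" where "\<phi> = I (\<lambda>z. v z * v z)"
definition \<phi>' :: "real \<Rightarrow> real" where "\<phi>' = I (\<lambda>z. v z * (2 * vx z))"
definition \<phi>'' :: "real \<Rightarrow> real" where "\<phi>'' = I (\<lambda>z. vx z * (2 * vx z) + v z * (2 * vxx z))"
definition D :: "real \<Rightarrow> real" where "D = I (\<lambda>z. vx z * vx z + vy z * vy z)"

lemma \<phi>_nonneg: "0 \<le> \<phi> x"
  unfolding \<phi>_def by (rule I_nonneg) auto

lemma D_nonneg: "0 \<le> D x"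
  unfolding D_def by (rule I_nonneg) auto

lemma \<phi>_fundamental:
  assumes "x0 < a" "a \<le> b"
  shows "set_integrable lborel {a..b} \<phi>'" "(LINT x:{a..b}|lborel. \<phi>' x) = \<phi> b - \<phi> a"
proof -
  have "I (\<lambda>z. vx z * v z + v z * vx z) = \<phi>'"
    unfolding \<phi>'_def by (intro ext I_cong) simp
  with I_fundamental[OF assms cont(1) cont(2) deriv_x]
  show "set_integrable lborel {a..b} \<phi>'" "(LINT x:{a..b}|lborel. \<phi>' x) = \<phi> b - \<phi> a"
    by (auto simp: \<phi>_def)
qed

lemma \<phi>'_fundamental:
  assumes "x0 < a" "a \<le> b"
  shows "set_integrable lborel {a..b} \<phi>''" "(LINT x:{a..b}|lborel. \<phi>'' x) = \<phi>' b - \<phi>' a"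
proof -
  have c: "continuous_on W (\<lambda>z. 2 * vx z)" "continuous_on W (\<lambda>z. 2 * vxx z)"
    by (intro continuous_intros cont)+
  show "set_integrable lborel {a..b} \<phi>''" "(LINT x:{a..b}|lborel. \<phi>'' x) = \<phi>' b - \<phi>' a"
    unfolding \<phi>'_def \<phi>''_def using I_fundamental[OF assms c DERIV_cmult[OF deriv_xx]] by auto
qed

lemma continuous_on_\<phi>':
  assumes "x0 < a"
  shows "continuous_on {a..b} \<phi>'"
proof (cases "a \<le> b")
  case True
  have eq: "\<phi>' x = \<phi>' a + integral {a..x} \<phi>''" if "x \<in> {a..b}" for x
    using \<phi>'_fundamental[OF assms, of x] that set_borel_integral_eq_integral(2)[of "{a..x}" \<phi>''] by simp
  have "continuous_on {a..b} (\<lambda>x. \<phi>' a + integral {a..x} \<phi>'')"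
    using indefinite_integral_continuous_1[OF
      set_borel_integral_eq_integral(1)[OF \<phi>'_fundamental(1)[OF assms True]]]
    by (intro continuous_on_add continuous_on_const)
  then show ?thesis by (rule continuous_on_eq) (rule eq[symmetric])
qed auto

text \<open>The Laplace equation replaces \<open>vxx\<close> by \<open>- c x - vyy\<close>; then
  \<open>- 2 * v * vyy\<close> may be traded for \<open>2 * vy\<^sup>2\<close> because
  \<open>I_vertical\<close> makes the difference integrate to zero.\<close>

lemma \<phi>''_eq:
  assumes x: "x0 < x"
  shows "\<phi>'' x = 2 * D x - 2 * c x * I v x"
proof -
  have "\<phi>'' x = I (\<lambda>z. (2 * (vx z * vx z + vy z * vy z) + (- 2) * (vy z * vy z + v z * vyy z)) + (- 2 * c x) * v z) x"
    unfolding \<phi>''_def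
  proof (rule I_cong)
    fix z assume "z \<in> P" "Re z = x"
    then have e: "vxx z = - c x - vyy z" using laplacian[of z] P_subset by auto
    show "vx z * (2 * vx z) + v z * (2 * vxx z) = 2 * (vx z * vx z + vy z * vy z) + (- 2) * (vy z * vy z + v z * vyy z) + (- 2 * c x) * v z"
      unfolding e by (simp add: algebra_simps)
  qed
  also have "\<dots> = I (\<lambda>z. 2 * (vx z * vx z + vy z * vy z)) x + I (\<lambda>z. (- 2) * (vy z * vy z + v z * vyy z)) x + I (\<lambda>z. (- 2 * c x) * v z) x"
  proof -
    have c: "continuous_on W (\<lambda>z. 2 * (vx z * vx z + vy z * vy z))"
      "continuous_on W (\<lambda>z. (- 2) * (vy z * vy z + v z * vyy z))" "continuous_on W (\<lambda>z. (- 2 * c x) * v z)"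
      by (intro continuous_intros cont)+
    show ?thesis
      by (simp only: I_add[OF x continuous_on_add[OF c(1,2)] c(3)] I_add[OF x c(1,2)])
  qed
  also have "\<dots> = 2 * D x - 2 * c x * I v x"
    unfolding I_mult I_vertical[OF x] D_def by simp
  finally show ?thesis .
qed

lemma D_bounds:
  assumes x: "x0 < x" and t: "t \<in> {0..2*pi}" "Complex x t \<notin> P"
    and mu: "0 < \<mu>" "\<mu> * I (\<lambda>_. 1) x \<le> pi"
  shows "\<mu>\<^sup>2 * \<phi> x \<le> D x" "\<mu> * \<phi>' x \<le> D x"
proof -
  have D: "D x = I (\<lambda>z. vx z * vx z) x + I (\<lambda>z. vy z * vy z) x"
    unfolding D_def by (rule I_add[OF x]; intro continuous_intros cont)
  have w: "\<mu>\<^sup>2 * \<phi> x \<le> I (\<lambda>z. vy z * vy z) x"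
    using I_wirtinger[OF assms] by (simp add: \<phi>_def)
  have "0 \<le> I (\<lambda>z. vx z * vx z) x" by (rule I_nonneg) auto
  with w D show "\<mu>\<^sup>2 * \<phi> x \<le> D x" by simp
  have "\<mu> * \<phi>' x = I (\<lambda>z. \<mu> * (v z * (2 * vx z))) x" unfolding I_mult \<phi>'_def ..
  also have "\<dots> \<le> I (\<lambda>z. vx z * vx z + \<mu>\<^sup>2 * (v z * v z)) x"
  proof (rule I_mono[OF x])
    fix z
    have "0 \<le> (vx z - \<mu> * v z)\<^sup>2" by simp
    then show "\<mu> * (v z * (2 * vx z)) \<le> vx z * vx z + \<mu>\<^sup>2 * (v z * v z)"
      by (simp add: power2_eq_square algebra_simps)
  qed (intro continuous_intros cont)+
  also have "\<dots> = I (\<lambda>z. vx z * vx z) x + \<mu>\<^sup>2 * \<phi> x"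
  proof -
    have c: "continuous_on W (\<lambda>z. vx z * vx z)" "continuous_on W (\<lambda>z. \<mu>\<^sup>2 * (v z * v z))"
      by (intro continuous_intros cont)+
    show ?thesis by (simp only: I_add[OF x c] I_mult \<phi>_def)
  qed
  also have "\<dots> \<le> D x" using w D by simp
  finally show "\<mu> * \<phi>' x \<le> D x" .
qed

text \<open>Cauchy-Schwarz with a free weight. Later \<open>l = exp (- x / 2)\<close>, which
  balances the two terms when \<open>\<phi> x\<close> is at least of order
  \<open>exp x\<close>.\<close>

lemma I_v_le:
  assumes x: "x0 < x" and l: "0 < l"
  shows "I v x \<le> l / 2 * \<phi> x + pi / l"
proof -
  have "I v x \<le> I (\<lambda>z. l / 2 * (v z * v z) + 1 / (2 * l) * 1) x"
  proof (rule I_mono[OF x])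
    fix z
    have "0 \<le> (l * v z - 1)\<^sup>2 / (2 * l)" using l by simp
    also have "(l * v z - 1)\<^sup>2 / (2 * l) = l / 2 * (v z * v z) + 1 / (2 * l) - v z"
      using l by (simp add: power2_eq_square field_simps)
    finally show "v z \<le> l / 2 * (v z * v z) + 1 / (2 * l) * 1" by simp
  qed (intro continuous_intros cont)+
  also have "\<dots> = l / 2 * \<phi> x + 1 / (2 * l) * I (\<lambda>_. 1) x"
  proof -
    have c: "continuous_on W (\<lambda>z. l / 2 * (v z * v z))" "continuous_on W (\<lambda>z::complex. 1 / (2 * l) * 1)"
      by (intro continuous_intros cont)+
    show ?thesis by (simp only: I_add[OF x c] I_mult \<phi>_def)
  qed
  also have "\<dots> \<le> l / 2 * \<phi> x + 1 / (2 * l) * (2 * pi)"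
    using I_one_le[OF x] l by (intro add_left_mono mult_left_mono) auto
  finally show ?thesis using l by simp
qed

end

section \<open>Growth of the mean square\<close>

text \<open>The integrated form of \<open>G \<le> (ln K)' + \<eta>\<close>, where \<open>K\<close>
  is known only as an indefinite integral of \<open>k\<close>. On short cells \<open>K\<close> is
  nearly constant and the estimate holds up to a factor \<open>1 + \<epsilon>\<close>; Bolzano
  bisection joins the cells, and \<open>\<epsilon>\<close> tends to 0.\<close>

lemma nn_integral_log_derivative_le:
  fixes K k G H \<eta> :: "real \<Rightarrow> real"
  assumes ab: "a \<le> b"
    and pos: "\<And>x. x \<in> {a..b} \<Longrightarrow> 0 < K x"
    and cont: "continuous_on {a..b} K"
    and mono: "\<And>s t. a \<le> s \<Longrightarrow> s \<le> t \<Longrightarrow> t \<le> b \<Longrightarrow> K s \<le> K t"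
    and intk: "set_integrable lborel {a..b} k"
    and K: "\<And>s t. a \<le> s \<Longrightarrow> s \<le> t \<Longrightarrow> t \<le> b \<Longrightarrow> (LINT x:{s..t}|lborel. k x) = K t - K s"
    and int\<eta>: "set_integrable lborel {a..b} \<eta>"
    and \<eta>0: "\<And>x. x \<in> {a..b} \<Longrightarrow> 0 \<le> \<eta> x"
    and H: "\<And>s t. a \<le> s \<Longrightarrow> s \<le> t \<Longrightarrow> t \<le> b \<Longrightarrow> (LINT x:{s..t}|lborel. \<eta> x) = H t - H s"
    and G [measurable]: "G \<in> borel_measurable borel"
    and G0: "\<And>x. x \<in> {a..b} \<Longrightarrow> 0 \<le> G x"
    and ineq: "\<And>x. x \<in> {a..b} \<Longrightarrow> G x * K x \<le> k x + \<eta> x * K x"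
  shows "(\<integral>\<^sup>+x\<in>{a..b}. ennreal (G x) \<partial>lborel) \<le> ennreal (ln (K b) - ln (K a) + (H b - H a))"
proof -
  define L where "L x = ln (K x) + H x" for x
  have Hmono: "H s \<le> H t" if "a \<le> s" "s \<le> t" "t \<le> b" for s t
  proof -
    have "0 \<le> (LINT x:{s..t}|lborel. \<eta> x)"
      unfolding set_lebesgue_integral_def
      by (intro integral_nonneg_AE AE_I2) (use \<eta>0 that in \<open>auto simp: indicator_def\<close>)
    then show ?thesis using H that by simp
  qed
  have lnmono: "ln (K s) \<le> ln (K t)" if "a \<le> s" "s \<le> t" "t \<le> b" for s t
    using mono[OF that] pos[of s] pos[of t] that by simp
  \<comment> \<open>On a cell \<open>K\<close> is replaced by \<open>K s\<close> where it multiplies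
    \<open>G\<close> and by \<open>K t\<close> where it multiplies \<open>\<eta>\<close>; each
    replacement goes in the right direction by monotonicity.\<close>
  have cell: "(\<integral>\<^sup>+x\<in>{s..t}. ennreal (G x) \<partial>lborel) \<le> ennreal ((1 + \<epsilon>) * (L t - L s))"
    if st: "a \<le> s" "s \<le> t" "t \<le> b" and e: "K t \<le> (1 + \<epsilon>) * K s" "0 < \<epsilon>" for s t \<epsilon>
  proof -
    have Ks: "K s > 0" "K t > 0" using pos st by auto
    have ik: "set_integrable lborel {s..t} k" "set_integrable lborel {s..t} \<eta>"
      using set_integrable_subset[OF intk, of "{s..t}"] set_integrable_subset[OF int\<eta>, of "{s..t}"] st by auto
    let ?F = "\<lambda>x. (k x + \<eta> x * K t) / K s"
    have iF: "set_integrable lborel {s..t} ?F"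
      using ik by (intro set_integrable_divide set_integral_add set_integrable_mult_left) auto
    have GF: "G x \<le> ?F x" if x: "x \<in> {s..t}" for x
    proof -
      have xab: "x \<in> {a..b}" using x st by auto
      have "G x * K s \<le> G x * K x" using mono[of s x] x st by (intro mult_left_mono G0 xab) auto
      also have "\<dots> \<le> k x + \<eta> x * K x" by (rule ineq[OF xab])
      also have "\<dots> \<le> k x + \<eta> x * K t" using mono[of x t] x st by (intro add_left_mono mult_left_mono \<eta>0 xab) auto
      finally show ?thesis using Ks by (simp add: pos_le_divide_eq)
    qed
    have "(\<integral>\<^sup>+x\<in>{s..t}. ennreal (G x) \<partial>lborel) \<le> (\<integral>\<^sup>+x. ennreal (indicator {s..t} x *\<^sub>R ?F x) \<partial>lborel)"
      by (intro nn_integral_mono) (auto simp: indicator_def intro!: ennreal_leI GF)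
    also have "\<dots> = ennreal (LINT x:{s..t}|lborel. ?F x)"
      unfolding set_lebesgue_integral_def
    proof (intro nn_integral_eq_integral AE_I2)
      show "integrable lborel (\<lambda>x. indicat_real {s..t} x *\<^sub>R ?F x)"
        using iF by (simp add: set_integrable_def)
      show "0 \<le> indicat_real {s..t} x *\<^sub>R ?F x" for x
        using GF[of x] G0[of x] st by (auto simp: indicator_def)
    qed
    also have "(LINT x:{s..t}|lborel. ?F x) = ((K t - K s) + (H t - H s) * K t) / K s"
      using ik st by (simp add: set_integral_add set_integrable_mult_left K H)
    also have "\<dots> \<le> (1 + \<epsilon>) * (L t - L s)"
    proof -
      define r where "r = K t / K s"
      have r: "1 \<le> r" "r \<le> 1 + \<epsilon>" using e Ks mono[OF st] by (auto simp: r_def pos_divide_le_eq)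
      have lnr: "ln r = ln (K t) - ln (K s)" unfolding r_def using Ks by (simp add: ln_div)
      have "ln (1 / r) \<le> 1 / r - 1" using r by (intro ln_le_minus_one) auto
      \<comment> \<open>Turns the relative increment \<open>r - 1\<close> into a logarithm at the
        price of the factor \<open>r\<close>, which is at most
        \<open>1 + \<epsilon>\<close>.\<close>
      then have "1 - 1 / r \<le> ln r" using r by (simp add: ln_div)
      then have "r * (1 - 1 / r) \<le> r * ln r" using r by (intro mult_left_mono) auto
      then have "r - 1 \<le> r * ln r" using r by (simp add: right_diff_distrib)
      also have "\<dots> \<le> (1 + \<epsilon>) * ln r" using r by (intro mult_right_mono) auto
      finally have A: "r - 1 \<le> (1 + \<epsilon>) * ln r" .
      have B: "(H t - H s) * r \<le> (H t - H s) * (1 + \<epsilon>)" using r Hmono[OF st] by (intro mult_left_mono) auto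
      have "((K t - K s) + (H t - H s) * K t) / K s = (r - 1) + (H t - H s) * r"
        using Ks by (simp add: r_def field_simps)
      also have "\<dots> \<le> (1 + \<epsilon>) * ln r + (H t - H s) * (1 + \<epsilon>)" using A B by simp
      also have "\<dots> = (1 + \<epsilon>) * (L t - L s)" by (simp add: L_def lnr algebra_simps)
      finally show ?thesis .
    qed
    finally show ?thesis by (simp add: ennreal_leI)
  qed
  have main: "(\<integral>\<^sup>+x\<in>{a..b}. ennreal (G x) \<partial>lborel) \<le> ennreal ((1 + \<epsilon>) * (L b - L a))" if e: "0 < \<epsilon>" for \<epsilon>
  proof -
    have Lmono: "L s \<le> L t" if "a \<le> s" "s \<le> t" "t \<le> b" for s t
      using Hmono[OF that] lnmono[OF that] by (simp add: L_def)
    \<comment> \<open>The premises make \<open>Q\<close> vacuous for intervals reaching outside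
      \<open>{a..b}\<close>, which the local step of Bolzano's principle must also admit.\<close>
    define Q where "Q s t \<longleftrightarrow> (a \<le> s \<longrightarrow> t \<le> b \<longrightarrow>
      (\<integral>\<^sup>+x\<in>{s..t}. ennreal (G x) \<partial>lborel) \<le> ennreal ((1 + \<epsilon>) * (L t - L s)))" for s t
    have "Q a b"
      using ab
    proof (induct rule: Bolzano)
      case (trans s m t)
      show ?case unfolding Q_def
      proof (intro impI)
        assume st: "a \<le> s" "t \<le> b"
        have "(\<integral>\<^sup>+x\<in>{s..t}. ennreal (G x) \<partial>lborel)
            \<le> (\<integral>\<^sup>+x. ennreal (G x) * indicator {s..m} x + ennreal (G x) * indicator {m..t} x \<partial>lborel)"
          by (intro nn_integral_mono) (auto simp: indicator_def)
        also have "\<dots> = (\<integral>\<^sup>+x\<in>{s..m}. ennreal (G x) \<partial>lborel) + (\<integral>\<^sup>+x\<in>{m..t}. ennreal (G x) \<partial>lborel)"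
          by (intro nn_integral_add) auto
        also have "\<dots> \<le> ennreal ((1 + \<epsilon>) * (L m - L s)) + ennreal ((1 + \<epsilon>) * (L t - L m))"
          using trans st by (intro add_mono) (auto simp: Q_def)
        also have "\<dots> = ennreal ((1 + \<epsilon>) * (L t - L s))"
        proof -
          have "0 \<le> (1 + \<epsilon>) * (L m - L s)" "0 \<le> (1 + \<epsilon>) * (L t - L m)"
            using Lmono[of s m] Lmono[of m t] trans st e by auto
          from ennreal_plus[OF this] show ?thesis by (simp add: algebra_simps)
        qed
        finally show "(\<integral>\<^sup>+x\<in>{s..t}. ennreal (G x) \<partial>lborel) \<le> ennreal ((1 + \<epsilon>) * (L t - L s))" .
      qed
    next
      case (local x)
      \<comment> \<open>Solves
        \<open>K x + \<delta> = (1 + \<epsilon>) * (K x - \<delta>)\<close>.\<close>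
      define \<delta> where "\<delta> = K x * \<epsilon> / (2 + \<epsilon>)"
      have Kx: "K x > 0" using pos local by auto
      have "\<delta> > 0" using Kx e by (simp add: \<delta>_def)
      then obtain d where d: "d > 0" "\<And>y. y \<in> {a..b} \<Longrightarrow> dist y x < d \<Longrightarrow> dist (K y) (K x) < \<delta>"
        using cont local unfolding continuous_on_iff by (metis atLeastAtMost_iff)
      have "(\<integral>\<^sup>+x\<in>{s..t}. ennreal (G x) \<partial>lborel) \<le> ennreal ((1 + \<epsilon>) * (L t - L s))"
        if "s \<le> x" "x \<le> t" "t - s < d" "a \<le> s" "t \<le> b" for s t
      proof (rule cell)
        have "dist (K t) (K x) < \<delta>" "dist (K s) (K x) < \<delta>"
          using that d(2)[of t] d(2)[of s] by (auto simp: dist_real_def)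
        then have b: "K t \<le> K x + \<delta>" "K x - \<delta> \<le> K s" by (auto simp: dist_real_def)
        have "K x + \<delta> = (1 + \<epsilon>) * (K x - \<delta>)"
          using e by (simp add: \<delta>_def field_simps)
        moreover have "(1 + \<epsilon>) * (K x - \<delta>) \<le> (1 + \<epsilon>) * K s"
          using e b by (intro mult_left_mono) auto
        ultimately show "K t \<le> (1 + \<epsilon>) * K s" using b by linarith
      qed (use that e in auto)
      then show ?case using d(1) unfolding Q_def by blast
    qed
    then show ?thesis by (simp add: Q_def)
  qed
  have L0: "L b - L a \<ge> 0" using Hmono[of a b] lnmono[of a b] ab by (simp add: L_def)
  have "(\<integral>\<^sup>+x\<in>{a..b}. ennreal (G x) \<partial>lborel) \<le> ennreal (L b - L a)"
  proof (rule ennreal_le_epsilon)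
    fix e :: real assume e: "0 < e"
    have "(\<integral>\<^sup>+x\<in>{a..b}. ennreal (G x) \<partial>lborel) \<le> ennreal ((1 + e / (L b - L a + 1)) * (L b - L a))"
      by (rule main) (use e L0 in auto)
    also have "\<dots> \<le> ennreal ((L b - L a) + e)"
    proof (rule ennreal_leI)
      have "e * (L b - L a) \<le> e * (L b - L a + 1)" using e by simp
      then have "e / (L b - L a + 1) * (L b - L a) \<le> e" using L0 by (simp add: field_simps)
      then show "(1 + e / (L b - L a + 1)) * (L b - L a) \<le> (L b - L a) + e" by (simp add: algebra_simps)
    qed
    also have "\<dots> = ennreal (L b - L a) + ennreal e" using L0 e by (intro ennreal_plus) auto
    finally show "(\<integral>\<^sup>+x\<in>{a..b}. ennreal (G x) \<partial>lborel) \<le> ennreal (L b - L a) + ennreal e" .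
  qed
  also have "L b - L a = ln (K b) - ln (K a) + (H b - H a)" by (simp add: L_def)
  finally show ?thesis .
qed

section \<open>Convexity, logarithmic growth and exponential growth of \<open>\<phi>\<close>\<close>

context carleman begin

lemma I_one_nonneg: "0 \<le> I (\<lambda>_. 1) x"
  by (rule I_nonneg) auto

lemma \<phi>_le:
  assumes x: "x0 < x" and le: "\<And>z. z \<in> P \<Longrightarrow> Re z = x \<Longrightarrow> v z \<le> b"
  shows "\<phi> x \<le> 2 * pi * b\<^sup>2"
proof -
  have "\<phi> x \<le> I (\<lambda>_. b\<^sup>2 * 1) x"
    unfolding \<phi>_def
  proof (rule I_mono[OF x])
    fix z assume z: "z \<in> P" "Re z = x"
    then have "0 < v z" "v z \<le> b" using le by (auto simp: P_def)
    then show "v z * v z \<le> b\<^sup>2 * 1" by (simp add: power2_eq_square mult_mono)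
  qed (intro continuous_intros cont)+
  also have "\<dots> = b\<^sup>2 * I (\<lambda>_. 1) x" by (rule I_mult)
  also have "\<dots> \<le> b\<^sup>2 * (2 * pi)" by (intro mult_left_mono I_one_le x) auto
  finally show ?thesis by (simp add: mult_ac)
qed

lemma \<phi>_pos:
  assumes x: "x0 < x" and y: "y \<in> {0..2*pi}" "Complex x y \<in> P"
  shows "0 < \<phi> x"
proof -
  let ?u = "\<lambda>y. tr v (Complex x y)"
  have isCont_sq: "isCont (\<lambda>y. (?u y)\<^sup>2) y" for y
  proof (cases "?u y = 0")
    case True
    from DERIV_isCont[OF tr_truncation_deriv(2)[OF x this]] show ?thesis .
  next
    case False
    then have "?u y > 0" by (auto simp: tr_def P_def split: if_splits)
    from DERIV_isCont[OF tr_truncation_deriv(1)[OF x this]] show ?thesis by (intro continuous_intros)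
  qed
  have eq: "tr (\<lambda>z. v z * v z) (Complex x y) = (?u y)\<^sup>2" for y by (simp add: tr_def power2_eq_square)
  have \<phi>: "\<phi> x = integral {0..2*pi} (\<lambda>y. (?u y)\<^sup>2)"
    unfolding \<phi>_def using I_eq_integral(2)[OF x continuous_on_mult[OF cont(1) cont(1)]]
    by (simp add: eq)
  have "\<phi> x \<noteq> 0"
  proof
    assume "\<phi> x = 0"
    then have "(?u y)\<^sup>2 = 0"
      unfolding \<phi> using y isCont_sq
      by (subst (asm) integral_eq_0_iff) (auto intro: continuous_at_imp_continuous_on)
    then show False using y by (simp add: tr_def P_def)
  qed
  with \<phi>_nonneg[of x] show ?thesis by simp
qed

text \<open>If the positivity set were null on this line, every \<open>\<mu>\<close> would be
  admissible in \<open>D_bounds\<close>, contradicting finiteness of \<open>D x\<close>. This gives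
  \<open>\<psi> > 0\<close>, hence meaning to \<open>pi / \<psi>\<close>.\<close>

lemma I_one_pos:
  assumes x: "x0 < x" and t: "t \<in> {0..2*pi}" "Complex x t \<notin> P" and pos: "0 < \<phi> x"
  shows "0 < I (\<lambda>_. 1) x"
proof (rule ccontr)
  assume "\<not> 0 < I (\<lambda>_. 1) x"
  with I_one_nonneg[of x] have z: "I (\<lambda>_. 1) x = 0" by simp
  define m where "m = sqrt ((D x + 1) / \<phi> x)"
  have "0 < m" "m\<^sup>2 = (D x + 1) / \<phi> x" using pos D_nonneg[of x] by (auto simp: m_def)
  moreover have "m\<^sup>2 * \<phi> x \<le> D x" by (rule D_bounds(1)[OF x t]) (use \<open>0 < m\<close> z in auto)
  ultimately show False using pos by simp
qed

lemma \<phi>'_mono: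
  assumes "x0 < s" "s \<le> t" and nonneg: "\<And>x. x \<in> {s..t} \<Longrightarrow> 0 \<le> \<phi>'' x"
  shows "\<phi>' s \<le> \<phi>' t"
proof -
  have "0 \<le> (LINT x:{s..t}|lborel. \<phi>'' x)"
    unfolding set_lebesgue_integral_def
    by (intro integral_nonneg_AE AE_I2) (use nonneg in \<open>auto simp: indicator_def\<close>)
  then show ?thesis using \<phi>'_fundamental(2)[OF assms(1,2)] by simp
qed

lemma \<phi>_increment:
  assumes st: "x0 < s" "s \<le> t" and nonneg: "\<And>x. x \<in> {s..t} \<Longrightarrow> 0 \<le> \<phi>'' x"
  shows "(t - s) * \<phi>' s \<le> \<phi> t - \<phi> s" "\<phi> t - \<phi> s \<le> (t - s) * \<phi>' t"
proof -
  note i = \<phi>_fundamental[OF st]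
  have const: "(LINT x:{s..t}|lborel. r) = (t - s) * r" for r :: real
    using st by (simp add: set_lebesgue_integral_def)
  have ic: "set_integrable lborel {s..t} (\<lambda>x. r)" for r :: real
    using st by (simp add: set_integrable_def)
  have "(LINT x:{s..t}|lborel. \<phi>' s) \<le> (LINT x:{s..t}|lborel. \<phi>' x)"
    by (intro set_integral_mono i ic \<phi>'_mono) (use st nonneg in auto)
  then show "(t - s) * \<phi>' s \<le> \<phi> t - \<phi> s" by (simp add: const i)
  have "(LINT x:{s..t}|lborel. \<phi>' x) \<le> (LINT x:{s..t}|lborel. \<phi>' t)"
    by (intro set_integral_mono i ic \<phi>'_mono) (use st nonneg in auto)
  then show "\<phi> t - \<phi> s \<le> (t - s) * \<phi>' t" by (simp add: const i)
qed

text \<open>The error is absorbed into \<open>D\<close>, which dominates \<open>\<phi>\<close>. The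
  first claim uses \<open>\<mu> = 1/2\<close>, admissible on every slit line since
  \<open>I (\<lambda>_. 1) x \<le> 2 * pi\<close>.\<close>

lemma \<phi>''_lower:
  assumes x: "x0 < x" and t: "t \<in> {0..2*pi}" "Complex x t \<notin> P"
    and E: "2 * c x * I v x \<le> e * \<phi> x / 2" "0 \<le> e" "e \<le> 1 / 2"
  shows "\<phi> x / 4 \<le> \<phi>'' x"
    and "1 / 2 \<le> \<mu> \<Longrightarrow> \<mu> * I (\<lambda>_. 1) x \<le> pi \<Longrightarrow> 0 \<le> \<phi>' x \<Longrightarrow> 2 * \<mu> * \<phi>' x \<le> \<phi>'' x + e * \<phi>' x"
proof -
  have D4: "\<phi> x / 4 \<le> D x"
    using D_bounds(1)[OF x t, of "1/2"] I_one_le[OF x] by (simp add: power2_eq_square)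
  have "e * \<phi> x \<le> 1 / 2 * \<phi> x" using E \<phi>_nonneg[of x] by (intro mult_right_mono) auto
  then show "\<phi> x / 4 \<le> \<phi>'' x" using E D4 \<phi>''_eq[OF x] by simp
  assume mu: "1 / 2 \<le> \<mu>" "\<mu> * I (\<lambda>_. 1) x \<le> pi" and K: "0 \<le> \<phi>' x"
  have b: "\<mu>\<^sup>2 * \<phi> x \<le> D x" "\<mu> * \<phi>' x \<le> D x"
    using D_bounds[OF x t _ mu(2)] mu(1) by auto
  \<comment> \<open>The share of \<open>2 * D x\<close> that the error consumes. Since
    \<open>\<mu>\<close> is at least 1/2, \<open>q \<le> 1\<close> and the loss
    \<open>2 * q * \<mu> = e / (2 * \<mu>)\<close> in the rate is at most \<open>e\<close>.\<close>
  define q where "q = e / (4 * \<mu>\<^sup>2)"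
  have mu2: "1 \<le> 4 * \<mu>\<^sup>2" using mult_mono[OF mu(1) mu(1)] mu(1) by (simp add: power2_eq_square)
  then have m0: "\<mu>\<^sup>2 > 0" by linarith
  have q: "0 \<le> q" "q \<le> 1" using E mu2 by (auto simp: q_def divide_le_eq)
  have "e * \<phi> x / 2 = 2 * q * (\<mu>\<^sup>2 * \<phi> x)" using m0 by (simp add: q_def)
  also have "\<dots> \<le> 2 * q * D x" using q by (intro mult_left_mono b) auto
  finally have "2 * (1 - q) * D x \<le> \<phi>'' x" using E \<phi>''_eq[OF x] by (simp add: algebra_simps)
  moreover have "2 * (1 - q) * (\<mu> * \<phi>' x) \<le> 2 * (1 - q) * D x"
    using q by (intro mult_left_mono b) auto
  moreover have "2 * q * \<mu> \<le> e"
  proof -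
    have "2 * q * \<mu> = e / (2 * \<mu>)" using mu by (simp add: q_def power2_eq_square)
    also have "\<dots> \<le> e" using mu E by (simp add: divide_le_eq mult_le_cancel_left1)
    finally show ?thesis .
  qed
  then have "2 * q * \<mu> * \<phi>' x \<le> e * \<phi>' x" using K by (rule mult_right_mono)
  ultimately show "2 * \<mu> * \<phi>' x \<le> \<phi>'' x + e * \<phi>' x" by (simp add: algebra_simps)
qed

text \<open>The rate \<open>\<mu>\<close> is left free below
  \<open>pi / I (\<lambda>_. 1) x\<close>, to serve both the constant 1/2 at a constant level and
  \<open>pi / \<psi> (exp x)\<close> at the power level.\<close>

lemma log_growth:
  assumes ab: "x0 < a" "a \<le> b"
    and slit: "\<And>x. x \<in> {a..b} \<Longrightarrow> \<exists>t\<in>{0..2*pi}. Complex x t \<notin> P"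
    and pos: "0 < \<phi>' a"
    and E: "\<And>x. x \<in> {a..b} \<Longrightarrow> 2 * c x * I v x \<le> \<eta> x * \<phi> x / 2"
    and \<eta>: "\<And>x. x \<in> {a..b} \<Longrightarrow> 0 \<le> \<eta> x" "\<And>x. x \<in> {a..b} \<Longrightarrow> \<eta> x \<le> 1 / 2"
    and int\<eta>: "set_integrable lborel {a..b} \<eta>"
    and H: "\<And>s t. a \<le> s \<Longrightarrow> s \<le> t \<Longrightarrow> t \<le> b \<Longrightarrow> (LINT x:{s..t}|lborel. \<eta> x) = H t - H s"
    and \<mu> [measurable]: "\<mu> \<in> borel_measurable borel"
    and \<mu>_bounds: "\<And>x. x \<in> {a..b} \<Longrightarrow> 1 / 2 \<le> \<mu> x" "\<And>x. x \<in> {a..b} \<Longrightarrow> \<mu> x * I (\<lambda>_. 1) x \<le> pi"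
  shows "(\<integral>\<^sup>+x\<in>{a..b}. ennreal (2 * \<mu> x) \<partial>lborel) \<le> ennreal (ln (\<phi>' b) - ln (\<phi>' a) + (H b - H a))"
proof -
  have nonneg: "0 \<le> \<phi>'' x" if x: "x \<in> {a..b}" for x
  proof -
    obtain t where "t \<in> {0..2*pi}" "Complex x t \<notin> P" using slit[OF x] by blast
    from \<phi>''_lower(1)[OF _ this E[OF x] \<eta>[OF x]] ab x \<phi>_nonneg[of x] show ?thesis by auto
  qed
  have mono: "\<phi>' s \<le> \<phi>' t" if "a \<le> s" "s \<le> t" "t \<le> b" for s t
    by (rule \<phi>'_mono) (use that ab nonneg in auto)
  have Kpos: "0 < \<phi>' x" if "x \<in> {a..b}" for x
    using mono[of a x] that pos by auto
  show ?thesis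
  proof (rule nn_integral_log_derivative_le[OF ab(2) Kpos continuous_on_\<phi>'[OF ab(1)] mono \<phi>'_fundamental(1)[OF ab] _ int\<eta> \<eta>(1) H])
    fix s t assume "a \<le> s" "s \<le> t" "t \<le> b"
    then show "(LINT x:{s..t}|lborel. \<phi>'' x) = \<phi>' t - \<phi>' s" using \<phi>'_fundamental(2)[of s t] ab by auto
  next
    fix x assume x: "x \<in> {a..b}"
    show "0 \<le> 2 * \<mu> x" using \<mu>_bounds(1)[OF x] by simp
    obtain t where "t \<in> {0..2*pi}" "Complex x t \<notin> P" using slit[OF x] by blast
    from \<phi>''_lower(2)[OF _ this E[OF x] \<eta>[OF x] \<mu>_bounds[OF x]] ab x Kpos[OF x]
    show "2 * \<mu> x * \<phi>' x \<le> \<phi>'' x + \<eta> x * \<phi>' x" by auto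
  qed auto
qed

text \<open>For harmonic \<open>v\<close> the mean square is convex, so the slope at
  \<open>a\<close> is at least that of the chord from \<open>s\<close>. Letting \<open>s\<close>
  decrease turns boundedness of \<open>\<phi>\<close> into \<open>\<phi>' a \<ge> 0\<close>.\<close>

lemma \<phi>'_lower:
  assumes "\<And>x. c x = 0" "x0 < s" "s \<le> a"
  shows "- \<phi> s \<le> (a - s) * \<phi>' a"
proof -
  have "\<phi> a - \<phi> s \<le> (a - s) * \<phi>' a"
    by (rule \<phi>_increment(2)) (use assms \<phi>''_eq D_nonneg in auto)
  then show ?thesis using \<phi>_nonneg[of a] by simp
qed

text \<open>The harmonic case with rate 1/2: \<open>ln \<phi>'\<close> has slope at least 1, and
  convexity over a unit step passes the growth of \<open>\<phi>'\<close> on to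
  \<open>\<phi>\<close>.\<close>

lemma \<phi>_exponential:
  assumes c: "\<And>x. c x = 0" and a: "x0 < a" "a < a'"
    and nonneg: "0 \<le> \<phi>' a" and pos: "0 < \<phi> a"
    and slit: "\<And>x. a \<le> x \<Longrightarrow> \<exists>t\<in>{0..2*pi}. Complex x t \<notin> P"
  obtains k where "0 < k" "\<And>x. a' + 1 \<le> x \<Longrightarrow> k * exp x \<le> \<phi> x"
proof -
  have n2: "0 \<le> \<phi>'' x" if "x0 < x" for x using c \<phi>''_eq[OF that] D_nonneg by simp
  have inc: "\<phi> a \<le> \<phi> x" if x: "a \<le> x" for x
  proof -
    have "0 \<le> (x - a) * \<phi>' a" using nonneg x by simp
    also have "\<dots> \<le> \<phi> x - \<phi> a" by (rule \<phi>_increment(1)) (use a x n2 in auto)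
    finally show ?thesis by simp
  qed
  \<comment> \<open>Starting from \<open>\<phi>' a = 0\<close> is allowed:
    \<open>\<phi>'' \<ge> \<phi> a / 4\<close> makes the slope positive by the time
    \<open>a'\<close> is reached, so that its logarithm exists.\<close>
  have pos': "0 < \<phi>' a'"
  proof -
    have "(LINT x:{a..a'}|lborel. \<phi> a / 4) \<le> (LINT x:{a..a'}|lborel. \<phi>'' x)"
    proof (intro set_integral_mono \<phi>'_fundamental(1))
      fix x assume x: "x \<in> {a..a'}"
      obtain t where "t \<in> {0..2*pi}" "Complex x t \<notin> P" using slit[of x] x by auto
      from \<phi>''_lower(1)[OF _ this, of 0] x a c inc[of x] show "\<phi> a / 4 \<le> \<phi>'' x" by auto
    qed (use a in \<open>auto simp: set_integrable_def\<close>)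
    also have "\<dots> = \<phi>' a' - \<phi>' a" by (rule \<phi>'_fundamental(2)) (use a in auto)
    finally have "(a' - a) * (\<phi> a / 4) \<le> \<phi>' a' - \<phi>' a"
      using a by (simp add: set_lebesgue_integral_def)
    moreover have "0 < (a' - a) * (\<phi> a / 4)" using a pos by simp
    ultimately show ?thesis using nonneg by linarith
  qed
  have K: "\<phi>' a' * exp (x - a') \<le> \<phi>' x" if x: "a' \<le> x" for x
  proof -
    have Kx: "0 < \<phi>' x" using pos' \<phi>'_mono[of a' x] x a n2 by force
    have "(\<integral>\<^sup>+y\<in>{a'..x}. ennreal (2 * (1 / 2)) \<partial>lborel) \<le> ennreal (ln (\<phi>' x) - ln (\<phi>' a') + (0 - 0))"
    proof (rule log_growth[where \<eta> = "\<lambda>_. 0" and H = "\<lambda>_. 0"])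
      fix y assume "y \<in> {a'..x}"
      then show "1 / 2 * I (\<lambda>_. 1) y \<le> pi" using I_one_le[of y] a by auto
    qed (use a x pos' slit c in \<open>auto simp: set_integrable_def set_lebesgue_integral_def\<close>)
    then have "ennreal (x - a') \<le> ennreal (ln (\<phi>' x) - ln (\<phi>' a'))" using x by simp
    moreover have "ln (\<phi>' a') \<le> ln (\<phi>' x)" using pos' Kx \<phi>'_mono[of a' x] x a n2 by force
    ultimately have "x - a' \<le> ln (\<phi>' x) - ln (\<phi>' a')" by (simp add: ennreal_le_iff)
    then have "exp (ln (\<phi>' a') + (x - a')) \<le> exp (ln (\<phi>' x))" by simp
    then show ?thesis using pos' Kx by (simp add: exp_add)
  qed
  show ?thesis
  proof (rule that[of "\<phi>' a' * exp (- a' - 1)"])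
    fix x assume x: "a' + 1 \<le> x"
    have "\<phi>' a' * exp (- a' - 1) * exp x = \<phi>' a' * exp (x - 1 - a')"
      by (simp add: exp_add[symmetric] mult.assoc)
    also have "\<dots> \<le> \<phi>' (x - 1)" by (rule K) (use x in auto)
    also have "\<dots> \<le> \<phi> x - \<phi> (x - 1)"
      using \<phi>_increment(1)[of "x - 1" x] x a n2 by auto
    also have "\<dots> \<le> \<phi> x" using \<phi>_nonneg by simp
    finally show "\<phi>' a' * exp (- a' - 1) * exp x \<le> \<phi> x" .
  qed (use pos' in auto)
qed

end

section \<open>Tracts of an entire function\<close>

lemma has_real_derivative_ln_norm:
  fixes g :: "real \<Rightarrow> complex"
  assumes g: "(g has_vector_derivative g') (at t)" and nz: "g t \<noteq> 0"
  shows "((\<lambda>t. ln (norm (g t))) has_real_derivative Re (g' / g t)) (at t)"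
proof -
  have re: "((\<lambda>t. Re (g t)) has_real_derivative Re g') (at t)"
    and im: "((\<lambda>t. Im (g t)) has_real_derivative Im g') (at t)"
    using bounded_linear.has_vector_derivative[OF bounded_linear_Re g]
      bounded_linear.has_vector_derivative[OF bounded_linear_Im g]
    by (simp_all add: has_real_derivative_iff_has_vector_derivative)
  have pos: "0 < (Re (g t))\<^sup>2 + (Im (g t))\<^sup>2" using nz
    by (metis cmod_power2 norm_eq_zero zero_less_power2)
  have eq: "ln (norm z) = ln ((Re z)\<^sup>2 + (Im z)\<^sup>2) / 2" for z :: complex
  proof (cases "z = 0")
    case False
    then have "ln ((norm z)\<^sup>2) = 2 * ln (norm z)" by (simp add: ln_realpow)
    then show ?thesis by (simp add: cmod_power2)
  qed auto
  have "((\<lambda>t. ln ((Re (g t))\<^sup>2 + (Im (g t))\<^sup>2) / 2) has_real_derivative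
      (1 / ((Re (g t))\<^sup>2 + (Im (g t))\<^sup>2) * (2 * Re (g t) * Re g' + 2 * Im (g t) * Im g')) / 2) (at t)"
  proof -
    have "((\<lambda>t. (Re (g t))\<^sup>2 + (Im (g t))\<^sup>2) has_real_derivative 2 * Re (g t) * Re g' + 2 * Im (g t) * Im g') (at t)"
      using DERIV_add[OF DERIV_power[OF re, of 2] DERIV_power[OF im, of 2]] by (simp add: mult_ac)
    from DERIV_cdivide[OF DERIV_chain2[OF DERIV_ln_divide[OF pos] this]] show ?thesis .
  qed
  moreover have "(1 / ((Re (g t))\<^sup>2 + (Im (g t))\<^sup>2) * (2 * Re (g t) * Re g' + 2 * Im (g t) * Im g')) / 2 = Re (g' / g t)"
  proof -
    have "(1 / N * (2 * a * b + 2 * c * d)) / 2 = (b * a + d * c) / N" for N a b c d :: real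
      by (simp add: add_divide_distrib distrib_left mult_ac)
    then show ?thesis by (simp only: Re_divide)
  qed
  ultimately show ?thesis by (simp add: eq[symmetric])
qed

lemma has_vector_derivative_Complex_Re:
  assumes "(f has_field_derivative f') (at z)"
  shows "((\<lambda>x. f (Complex x (Im z))) has_vector_derivative f') (at (Re z))"
proof -
  have "((\<lambda>x. Complex x (Im z)) has_vector_derivative 1) (at (Re z))"
    unfolding Complex_eq by (auto intro!: derivative_eq_intros)
  from field_vector_diff_chain_at[OF this, of f f'] assms show ?thesis by (simp add: o_def)
qed

lemma has_vector_derivative_Complex_Im:
  assumes "(f has_field_derivative f') (at z)"
  shows "((\<lambda>y. f (Complex (Re z) y)) has_vector_derivative \<i> * f') (at (Im z))"
proof -
  have "((\<lambda>y. Complex (Re z) y) has_vector_derivative \<i>) (at (Im z))"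
    unfolding Complex_eq by (auto intro!: derivative_eq_intros)
  from field_vector_diff_chain_at[OF this, of f f'] assms show ?thesis by (simp add: o_def)
qed

locale tract =
  fixes f :: "complex \<Rightarrow> complex" and R :: real and U :: "complex set"
  assumes entire: "f holomorphic_on UNIV" and R_pos: "R > 0"
    and U_comp: "U \<in> components {z. norm (f z) > R}"
begin

definition W :: "complex set" where "W = exp -` U"
definition F :: "complex \<Rightarrow> complex" where "F z = f (exp z)"
text \<open>The logarithmic derivative of \<open>F\<close>. The partial derivatives of
  \<open>ln (norm (F z))\<close> are \<open>Re (q z)\<close> and \<open>- Im (q z)\<close>, so no
  branch of the logarithm has to be chosen.\<close>

definition q :: "complex \<Rightarrow> complex" where "q z = exp z * deriv f (exp z) / f (exp z)"

text \<open>The power level \<open>A = 0, B = 1\<close> gives the set \<open>V\<close>; a constant level \<open>B = 0\<close> makes \<open>v\<close> harmonic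
  and is needed first, to know that the tract carries growth of order at least \<open>1/2\<close>.\<close>

definition v where "v A B \<beta> z = ln (norm (F z)) - (A + B * exp (\<beta> * Re z))"
definition vx where "vx B \<beta> z = Re (q z) - B * \<beta> * exp (\<beta> * Re z)"
definition vy where "vy z = - Im (q z)"
definition vxx where "vxx B \<beta> z = Re (deriv q z) - B * \<beta>\<^sup>2 * exp (\<beta> * Re z)"
definition vyy where "vyy z = - Re (deriv q z)"

lemma open_superlevel: "open {z. norm (f z) > R}"
  by (intro open_Collect_less continuous_intros holomorphic_on_imp_continuous_on entire)

lemma open_U: "open U"
  using open_components[OF open_superlevel U_comp] .

lemma U_subset: "z \<in> U \<Longrightarrow> norm (f z) > R"
  using in_components_subset[OF U_comp] by auto

lemma open_W: "open W"
  unfolding W_def by (intro open_vimage open_U continuous_intros)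

lemma F_nonzero: "z \<in> W \<Longrightarrow> F z \<noteq> 0"
  using U_subset[of "exp z"] R_pos by (auto simp: W_def F_def)

lemma F_deriv: "(F has_field_derivative exp z * deriv f (exp z)) (at z)"
proof -
  have "(f has_field_derivative deriv f (exp z)) (at (exp z))"
    using holomorphic_derivI[OF entire open_UNIV] by simp
  from DERIV_chain2[OF this DERIV_exp] show ?thesis unfolding F_def by (simp add: mult.commute)
qed

lemma continuous_F: "isCont F z"
  using DERIV_isCont[OF F_deriv] .

lemma q_holomorphic: "q holomorphic_on W"
proof -
  have "deriv f holomorphic_on UNIV" by (intro holomorphic_deriv entire open_UNIV)
  then have h: "(deriv f \<circ> exp) holomorphic_on W" "(f \<circ> exp) holomorphic_on W"
    using entire by (auto intro!: holomorphic_on_compose_gen[where t = UNIV] holomorphic_intros)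
  have "(\<lambda>z. exp z * deriv f (exp z) / f (exp z)) holomorphic_on W"
    using F_nonzero h[unfolded o_def] by (intro holomorphic_intros) (auto simp: F_def)
  then show ?thesis by (simp only: q_def[abs_def])
qed

lemma q_deriv: "z \<in> W \<Longrightarrow> (q has_field_derivative deriv q z) (at z)"
  using holomorphic_derivI[OF q_holomorphic open_W] .

lemma exp_periodic: "exp (Complex x (2 * pi)) = exp (Complex x 0)"
  by (simp add: complex_eq_iff Re_exp Im_exp)

text \<open>The substantial axiom is \<open>boundary\<close>. Outside \<open>W\<close> there are two
  kinds of points: those with \<open>norm (F z) > R\<close> lie over another component, whose open
  preimage misses \<open>W\<close>; at the others the level exceeds \<open>ln R\<close>, so
  \<open>v\<close> is negative on nearby points of \<open>W\<close>.\<close>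

lemma carleman:
  assumes above: "\<And>x. x0 < x \<Longrightarrow> ln R < A + B * exp (\<beta> * x)"
  shows "carleman W (v A B \<beta>) (vx B \<beta>) vy (vxx B \<beta>) vyy (\<lambda>x. B * \<beta>\<^sup>2 * exp (\<beta> * x)) x0"
proof
  have cF: "continuous_on W F" using continuous_F by (auto intro: continuous_at_imp_continuous_on)
  have cq: "continuous_on W q" by (rule holomorphic_on_imp_continuous_on[OF q_holomorphic])
  have cq': "continuous_on W (deriv q)"
    by (intro holomorphic_on_imp_continuous_on holomorphic_deriv q_holomorphic open_W)
  show "open W" by (rule open_W)
  show "continuous_on W (v A B \<beta>)" unfolding v_def[abs_def]
    by (intro continuous_intros cF) (auto simp: F_nonzero)
  show "continuous_on W (vx B \<beta>)" unfolding vx_def[abs_def] by (intro continuous_intros cq)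
  show "continuous_on W vy" unfolding vy_def[abs_def] by (intro continuous_intros cq)
  show "continuous_on W (vxx B \<beta>)" unfolding vxx_def[abs_def] by (intro continuous_intros cq')
  show "continuous_on W vyy" unfolding vyy_def[abs_def] by (intro continuous_intros cq')
next
  fix z assume z: "z \<in> W"
  have qF: "q z = exp z * deriv f (exp z) / F z" by (simp add: q_def F_def)
  note lnx = has_real_derivative_ln_norm[OF has_vector_derivative_Complex_Re[OF F_deriv]]
  note lny = has_real_derivative_ln_norm[OF has_vector_derivative_Complex_Im[OF F_deriv]]
  have "((\<lambda>x. ln (cmod (F (Complex x (Im z))))) has_real_derivative Re (q z)) (at (Re z))"
    using lnx[of z] F_nonzero[OF z] by (simp add: qF)
  moreover have "((\<lambda>x. A + B * exp (\<beta> * x)) has_real_derivative B * \<beta> * exp (\<beta> * Re z)) (at (Re z))"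
    by (auto intro!: derivative_eq_intros)
  ultimately show "((\<lambda>x. v A B \<beta> (Complex x (Im z))) has_real_derivative vx B \<beta> z) (at (Re z))"
    using DERIV_diff by (fastforce simp: v_def vx_def)
  have "((\<lambda>y. ln (cmod (F (Complex (Re z) y)))) has_real_derivative Re (\<i> * q z)) (at (Im z))"
    using lny[of z] F_nonzero[OF z] by (simp add: qF)
  from DERIV_diff[OF this DERIV_const, of "A + B * exp (\<beta> * Re z)"]
  show "((\<lambda>y. v A B \<beta> (Complex (Re z) y)) has_real_derivative vy z) (at (Im z))"
    by (simp add: v_def vy_def)
  have "((\<lambda>x. Re (q (Complex x (Im z)))) has_real_derivative Re (deriv q z)) (at (Re z))"
    using bounded_linear.has_vector_derivative[OF bounded_linear_Re has_vector_derivative_Complex_Re[OF q_deriv[OF z]]]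
    by (simp add: has_real_derivative_iff_has_vector_derivative)
  moreover have "((\<lambda>x. B * \<beta> * exp (\<beta> * x)) has_real_derivative B * \<beta>\<^sup>2 * exp (\<beta> * Re z)) (at (Re z))"
    by (auto intro!: derivative_eq_intros simp: power2_eq_square)
  ultimately show "((\<lambda>x. vx B \<beta> (Complex x (Im z))) has_real_derivative vxx B \<beta> z) (at (Re z))"
    using DERIV_diff by (fastforce simp: vx_def vxx_def)
  have "((\<lambda>y. Im (q (Complex (Re z) y))) has_real_derivative Im (\<i> * deriv q z)) (at (Im z))"
    using bounded_linear.has_vector_derivative[OF bounded_linear_Im has_vector_derivative_Complex_Im[OF q_deriv[OF z]]]
    by (simp add: has_real_derivative_iff_has_vector_derivative)
  from DERIV_minus[OF this] show "((\<lambda>y. vy (Complex (Re z) y)) has_real_derivative vyy z) (at (Im z))"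
    by (simp add: vy_def vyy_def)
  show "vxx B \<beta> z + vyy z = - (B * \<beta>\<^sup>2 * exp (\<beta> * Re z))"
    by (simp add: vxx_def vyy_def)
next
  fix z assume z: "x0 < Re z" "z \<notin> W"
  show "\<forall>\<^sub>F w in nhds z. w \<notin> W \<or> v A B \<beta> w < 0"
  proof (cases "norm (F z) > R")
    case True
    then have "exp z \<in> \<Union> (components {z. norm (f z) > R})" by (simp add: F_def Union_components[symmetric])
    then obtain U' where U': "U' \<in> components {z. norm (f z) > R}" "exp z \<in> U'" by blast
    then have "U \<noteq> U'" using z by (auto simp: W_def)
    then have disj: "U \<inter> U' = {}" using components_nonoverlap[OF U_comp U'(1)] by simp
    have "open (exp -` U')"
      by (intro open_vimage open_components[OF open_superlevel U'(1)] continuous_intros)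
    from eventually_nhds_in_open[OF this, of z] U'(2) show ?thesis
      using disj by (auto simp: W_def elim!: eventually_mono)
  next
    case False
    \<comment> \<open>Levels are compared through \<open>exp\<close> because \<open>F\<close> may
      vanish outside \<open>W\<close>, where \<open>ln\<close> says nothing.\<close>
    define G where "G w = exp (A + B * exp (\<beta> * Re w)) - norm (F w)" for w
    have "norm (F z) \<le> exp (ln R)" using False R_pos by simp
    also have "\<dots> < exp (A + B * exp (\<beta> * Re z))" using above[OF z(1)] by simp
    finally have "0 < G z" by (simp add: G_def)
    moreover have "isCont G z" unfolding G_def
      by (intro continuous_intros continuous_F linear_continuous_at[OF bounded_linear_Re])
    ultimately have "\<forall>\<^sub>F w in nhds z. 0 < G w"
      by (auto simp: continuous_at tendsto_nhds_iff intro: order_tendstoD)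
    then show ?thesis
    proof eventually_elim
      case (elim w)
      show ?case
      proof (cases "w \<in> W")
        case True
        then have "0 < norm (F w)" using F_nonzero by simp
        with elim have "ln (norm (F w)) < ln (exp (A + B * exp (\<beta> * Re w)))"
          unfolding G_def by (subst ln_less_cancel_iff) auto
        then show ?thesis by (simp add: v_def)
      qed auto
    qed
  qed
next
  fix x
  show "(Complex x (2 * pi) \<in> W) = (Complex x 0 \<in> W)" by (simp add: W_def exp_periodic)
  show "v A B \<beta> (Complex x (2 * pi)) = v A B \<beta> (Complex x 0)" by (simp add: v_def F_def exp_periodic)
  show "vy (Complex x (2 * pi)) = vy (Complex x 0)" by (simp add: vy_def q_def exp_periodic)
qed

end

section \<open>Lower bound for the maximum modulus\<close>

lemma integral_exp_decay:
  fixes C \<delta> :: real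
  assumes "0 < \<delta>" "s \<le> t"
  shows "set_integrable lborel {s..t} (\<lambda>x. C * exp (- \<delta> * x))"
    "(LINT x:{s..t}|lborel. C * exp (- \<delta> * x)) = - C / \<delta> * exp (- \<delta> * t) - (- C / \<delta> * exp (- \<delta> * s))"
proof -
  show "set_integrable lborel {s..t} (\<lambda>x. C * exp (- \<delta> * x))"
    by (intro borel_integrable_atLeastAtMost' continuous_intros)
  have "(LINT x|lborel. (C * exp (- \<delta> * x)) * indicator {s..t} x) = - C / \<delta> * exp (- \<delta> * t) - (- C / \<delta> * exp (- \<delta> * s))"
    by (rule integral_FTC_Icc_real) (use assms in \<open>auto intro!: derivative_eq_intros continuous_intros\<close>)
  then show "(LINT x:{s..t}|lborel. C * exp (- \<delta> * x)) = - C / \<delta> * exp (- \<delta> * t) - (- C / \<delta> * exp (- \<delta> * s))"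
    by (simp add: set_lebesgue_integral_def mult_ac)
qed

lemma measurable_arc_measure:
  assumes V: "V \<in> sets (borel :: complex measure)"
  shows "(\<lambda>r. measure lborel {t \<in> {a..b}. complex_of_real r * cis t \<in> V}) \<in> borel_measurable borel"
proof -
  let ?Q = "{p \<in> space (borel \<Otimes>\<^sub>M borel). snd p \<in> {a..b} \<and> complex_of_real (fst p) * cis (snd p) \<in> V}"
  have "cis \<in> borel_measurable borel"
    by (intro borel_measurable_continuous_onI continuous_intros)
  then have "?Q \<in> sets (borel \<Otimes>\<^sub>M (borel :: real measure))"
    using V by measurable
  then have Q: "?Q \<in> sets (borel \<Otimes>\<^sub>M (lborel :: real measure))" by simp
  have "(\<lambda>r. enn2real (emeasure lborel (Pair r -` ?Q))) \<in> borel_measurable borel"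
    using lborel.measurable_emeasure_Pair[OF Q] by measurable
  moreover have "Pair r -` ?Q = {t \<in> {a..b}. complex_of_real r * cis t \<in> V}" for r
    by (auto simp: space_pair_measure)
  ultimately show ?thesis by (simp add: measure_def)
qed

context tract begin

lemma sets_power_level: "{z \<in> U. norm (f z) \<ge> exp (norm z powr \<beta>)} \<in> sets borel"
proof -
  have "f \<in> borel_measurable borel"
    by (intro borel_measurable_continuous_onI holomorphic_on_imp_continuous_on entire)
  then have "{z \<in> space borel. norm (f z) \<ge> exp (norm z powr \<beta>)} \<in> sets borel" by measurable
  moreover have "{z \<in> U. norm (f z) \<ge> exp (norm z powr \<beta>)}
      = U \<inter> {z \<in> space borel. norm (f z) \<ge> exp (norm z powr \<beta>)}" by auto
  ultimately show ?thesis using open_U by auto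
qed

lemma norm_F_le:
  assumes "norm (exp z) \<le> r"
  shows "\<exists>w\<in>cball 0 r. norm (F z) \<le> norm (f w)"
  using assms by (intro bexI[of _ "exp z"]) (auto simp: F_def)

lemma norm_F_le_maxmod: "norm (F z) \<le> maxmod f (exp (Re z))"
  unfolding maxmod_def
proof (rule cSup_upper)
  show "norm (F z) \<in> (\<lambda>z. norm (f z)) ` sphere 0 (exp (Re z))" by (auto simp: F_def)
  have "compact ((\<lambda>z. norm (f z)) ` sphere 0 (exp (Re z)))"
    by (intro compact_continuous_image continuous_intros holomorphic_on_imp_continuous_on
        holomorphic_on_subset[OF entire]) auto
  then show "bdd_above ((\<lambda>z. norm (f z)) ` sphere 0 (exp (Re z)))"
    by (intro bounded_imp_bdd_above compact_imp_bounded)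
qed

lemma slit_abscissas:
  assumes "\<exists>r1. \<forall>r\<ge>r1. \<not> sphere 0 r \<subseteq> U"
  obtains x1 where "\<And>x. x1 \<le> x \<Longrightarrow> \<exists>t\<in>{0..2*pi}. Complex x t \<notin> W"
proof -
  obtain r1 where r1: "\<And>r. r1 \<le> r \<Longrightarrow> \<not> sphere 0 r \<subseteq> U" using assms by blast
  have "\<exists>t\<in>{0..2*pi}. Complex x t \<notin> W" if x: "ln (max 1 r1) \<le> x" for x
  proof -
    have "r1 \<le> exp (ln (max 1 r1))" by (subst exp_ln) auto
    also have "\<dots> \<le> exp x" using x by (simp only: exp_le_cancel_iff)
    finally have "r1 \<le> exp x" .
    from r1[OF this] obtain w where w: "norm w = exp x" "w \<notin> U" by (auto simp: subset_iff)
    have "exp (Complex x (Arg2pi w)) = w"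
      using Arg2pi_eq[of w] w by (simp add: Complex_eq exp_add exp_of_real)
    then show ?thesis using w Arg2pi[of w] by (intro bexI[of _ "Arg2pi w"]) (auto simp: W_def)
  qed
  then show ?thesis using that by blast
qed

lemma carleman_power:
  assumes "0 < \<beta>"
  shows "carleman W (v 0 1 \<beta>) (vx 1 \<beta>) vy (vxx 1 \<beta>) vyy (\<lambda>x. 1 * \<beta>\<^sup>2 * exp (\<beta> * x)) (ln R / \<beta>)"
proof (rule carleman)
  fix x assume "ln R / \<beta> < x"
  then have "ln R < \<beta> * x" using assms by (simp add: field_simps)
  also have "\<dots> \<le> exp (\<beta> * x)" using exp_ge_add_one_self[of "\<beta> * x"] by linarith
  finally show "ln R < 0 + 1 * exp (\<beta> * x)" by simp
qed

text \<open>A level strictly between \<open>ln R\<close> and \<open>ln (norm (f z0))\<close> keeps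
  \<open>v\<close> harmonic, negative near the boundary of \<open>W\<close> and positive somewhere.
  Convexity and boundedness to the left give \<open>\<phi>' \<ge> 0\<close>, after which
  \<open>\<phi>_exponential\<close> applies.\<close>

lemma constant_level_growth:
  assumes "\<exists>r1. \<forall>r\<ge>r1. \<not> sphere 0 r \<subseteq> U"
  obtains A k x2 where "ln R < A" "0 < k" "\<And>x. x2 \<le> x \<Longrightarrow> k * exp x \<le> carleman.\<phi> W (v A 0 0) x"
proof -
  obtain x1 where x1: "\<And>x. x1 \<le> x \<Longrightarrow> \<exists>t\<in>{0..2*pi}. Complex x t \<notin> W"
    using slit_abscissas[OF assms] by blast
  obtain z0 where z0: "z0 \<in> U" "z0 \<noteq> 0"
  proof -
    have "U \<noteq> {}" using in_components_nonempty[OF U_comp] .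
    moreover have "U \<noteq> {0}" using open_U not_open_singleton[of "0::complex"] by metis
    ultimately show ?thesis using that by blast
  qed
  have "ln R < ln (norm (f z0))" using U_subset[OF z0(1)] R_pos
    by (subst ln_less_cancel_iff) linarith+
  then obtain A where A: "ln R < A" "A < ln (norm (f z0))" using dense by blast
  define X where "X = ln (norm z0)"
  have X: "Complex X (Arg2pi z0) \<in> W" "0 < v A 0 0 (Complex X (Arg2pi z0))"
  proof -
    have "exp (Complex X (Arg2pi z0)) = z0"
      using Arg2pi_eq[of z0] z0 by (simp add: X_def Complex_eq exp_add exp_of_real)
    then show "Complex X (Arg2pi z0) \<in> W" "0 < v A 0 0 (Complex X (Arg2pi z0))"
      using z0 A by (auto simp: W_def v_def F_def)
  qed
  \<comment> \<open>A constant level above \<open>ln R\<close> works for every \<open>x0\<close>;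
    this permits going to arbitrarily negative abscissas below.\<close>
  have car: "carleman W (v A 0 0) (vx 0 0) vy (vxx 0 0) vyy (\<lambda>x. 0) x0" for x0
    using carleman[of x0 A 0 0] A by simp
  let ?\<phi> = "carleman.\<phi> W (v A 0 0)"
  let ?\<phi>' = "carleman.\<phi>' W (v A 0 0) (vx 0 0)"
  \<comment> \<open>The mean square is convex and bounded near \<open>- \<infinity>\<close>, where \<open>exp z\<close> tends to \<open>0\<close>.\<close>
  have nonneg: "0 \<le> ?\<phi>' a" for a
  proof (rule ccontr)
    assume neg: "\<not> 0 \<le> ?\<phi>' a"
    have "compact ((\<lambda>z. norm (f z)) ` cball 0 (exp a))"
      by (intro compact_continuous_image continuous_intros holomorphic_on_imp_continuous_on
          holomorphic_on_subset[OF entire]) auto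
    then obtain B where B: "\<And>w. w \<in> cball 0 (exp a) \<Longrightarrow> norm (f w) \<le> B"
      by (fastforce dest!: compact_imp_bounded simp: bounded_iff)
    define M where "M = 2 * pi * (ln B - A)\<^sup>2"
    have M: "?\<phi> s \<le> M" if s: "s \<le> a" for s
    proof -
      interpret carleman W "v A 0 0" "vx 0 0" vy "vxx 0 0" vyy "\<lambda>x. 0" "s - 1" by (rule car)
      show ?thesis unfolding M_def
      proof (rule \<phi>_le)
        fix z assume z: "z \<in> P" "Re z = s"
        have "norm (F z) \<le> B" using norm_F_le[of z "exp a"] z s B by fastforce
        moreover have "0 < norm (F z)" using z P_subset F_nonzero by auto
        ultimately have "ln (norm (F z)) \<le> ln B" by (subst ln_le_cancel_iff) linarith+
        then show "v A 0 0 z \<le> ln B - A" by (simp add: v_def)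
      qed simp
    qed
    \<comment> \<open>Far enough left that a negative slope at \<open>a\<close> would force
      \<open>\<phi> s \<ge> M + 1\<close>.\<close>
    define s where "s = a - (M + 1) / (- ?\<phi>' a)"
    have M0: "0 \<le> M" by (simp add: M_def)
    then have sa: "s \<le> a" using neg by (simp add: s_def divide_nonneg_neg)
    have "- ?\<phi> s \<le> (a - s) * ?\<phi>' a"
      by (rule carleman.\<phi>'_lower[OF car[of "s - 1"]]) (use sa in auto)
    also have "(a - s) * ?\<phi>' a = - (M + 1)" using neg by (simp add: s_def)
    finally show False using M[OF sa] by simp
  qed
  define a where "a = max X x1"
  interpret carleman W "v A 0 0" "vx 0 0" vy "vxx 0 0" vyy "\<lambda>x. 0" "X - 1" by (rule car)
  have "0 < \<phi> X"
    by (rule \<phi>_pos[where y = "Arg2pi z0"]) (use X Arg2pi[of z0] in \<open>auto simp: P_def\<close>)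
  also have "\<phi> X \<le> \<phi> a"
  proof -
    have "0 \<le> (a - X) * \<phi>' X" using nonneg by (simp add: a_def)
    also have "\<dots> \<le> \<phi> a - \<phi> X"
      by (rule \<phi>_increment(1)) (use \<phi>''_eq D_nonneg in \<open>auto simp: a_def\<close>)
    finally show ?thesis by simp
  qed
  finally have pos: "0 < \<phi> a" .
  have slit: "\<exists>t\<in>{0..2*pi}. Complex x t \<notin> P" if "a \<le> x" for x
    using x1[of x] that P_subset by (auto simp: a_def)
  have "X - 1 < a" "a < a + 1" by (auto simp: a_def)
  from \<phi>_exponential[OF refl this nonneg pos slit]
  obtain k where "0 < k" "\<And>x. (a + 1) + 1 \<le> x \<Longrightarrow> k * exp x \<le> \<phi> x" by blast
  then show ?thesis using that A by blast
qed

text \<open>Changing the level alters \<open>v\<close> by at most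
  \<open>exp (\<beta> * x) + \<bar>A\<bar>\<close>, so the two mean squares differ, up to a factor
  2, by \<open>O(exp (2 * \<beta> * x))\<close>. This is negligible against \<open>exp x\<close>
  because \<open>\<beta> < 1/2\<close>.\<close>

lemma power_level_growth:
  assumes slit: "\<exists>r1. \<forall>r\<ge>r1. \<not> sphere 0 r \<subseteq> U" and \<beta>: "0 < \<beta>" "\<beta> < 1 / 2"
  obtains k x3 where "0 < k" "\<And>x. x3 \<le> x \<Longrightarrow> k * exp x \<le> carleman.\<phi> W (v 0 1 \<beta>) x"
proof -
  obtain A k x2 where A: "ln R < A" and k: "0 < k"
    and x2: "\<And>x. x2 \<le> x \<Longrightarrow> k * exp x \<le> carleman.\<phi> W (v A 0 0) x"
    using constant_level_growth[OF slit] by blast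
  interpret B: carleman W "v 0 1 \<beta>" "vx 1 \<beta>" vy "vxx 1 \<beta>" vyy "\<lambda>x. 1 * \<beta>\<^sup>2 * exp (\<beta> * x)" "ln R / \<beta>"
    by (rule carleman_power[OF \<beta>(1)])
  interpret A: carleman W "v A 0 0" "vx 0 0" vy "vxx 0 0" vyy "\<lambda>x. 0 * 0\<^sup>2 * exp (0 * x)" "ln R / \<beta>"
    using A by (intro carleman) simp
  have le: "A.\<phi> x \<le> 2 * B.\<phi> x + 4 * pi * (exp (\<beta> * x) + \<bar>A\<bar>)\<^sup>2" if x: "ln R / \<beta> < x" for x
  proof -
    define m where "m = exp (\<beta> * x) + \<bar>A\<bar>"
    have m: "0 < m" by (simp add: m_def add_pos_nonneg)
    note iA = A.tr_set_integrable[OF x continuous_on_mult[OF A.cont(1) A.cont(1)]]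
    note iB = B.tr_set_integrable[OF x continuous_on_mult[OF B.cont(1) B.cont(1)]]
    have ic: "set_integrable lborel {0..2*pi} (\<lambda>y. r)" for r :: real by (simp add: set_integrable_def)
    have "A.\<phi> x \<le> (LINT y:{0..2*pi}|lborel. 2 * B.tr (\<lambda>z. v 0 1 \<beta> z * v 0 1 \<beta> z) (Complex x y) + 2 * m\<^sup>2)"
      unfolding A.\<phi>_def A.I_def
    proof (intro set_integral_mono iA set_integral_add set_integrable_mult_right iB ic)
      fix y
      let ?z = "Complex x y"
      define p where "p = v A 0 0 ?z"
      define q where "q = v 0 1 \<beta> ?z"
      have pq: "p \<le> q + m" by (simp add: p_def q_def v_def m_def)
      have sq: "p * p \<le> 2 * (max 0 q * max 0 q) + 2 * m\<^sup>2" if "0 < p"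
      proof -
        have "p\<^sup>2 \<le> (max 0 q + m)\<^sup>2" using that pq by (intro power_mono) auto
        also have "\<dots> \<le> 2 * (max 0 q)\<^sup>2 + 2 * m\<^sup>2"
          using sum_squares_bound[of "max 0 q" m] by (simp add: power2_sum)
        finally show ?thesis by (simp add: power2_eq_square)
      qed
      have B: "B.tr (\<lambda>z. v 0 1 \<beta> z * v 0 1 \<beta> z) ?z = (if ?z \<in> W then max 0 q * max 0 q else 0)"
        by (auto simp: B.tr_def B.P_def q_def)
      show "A.tr (\<lambda>z. v A 0 0 z * v A 0 0 z) ?z \<le> 2 * B.tr (\<lambda>z. v 0 1 \<beta> z * v 0 1 \<beta> z) ?z + 2 * m\<^sup>2"
        unfolding B A.tr_def A.P_def using sq by (auto simp: p_def)
    qed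
    also have "\<dots> = 2 * B.\<phi> x + 4 * pi * m\<^sup>2"
      unfolding B.\<phi>_def B.I_def
      by (subst set_integral_add) (auto intro!: set_integrable_mult_right iB ic simp: set_lebesgue_integral_def[of _ _ "\<lambda>_. _"])
    finally show ?thesis by (simp add: m_def)
  qed
  \<comment> \<open>Chosen so that the correction is at most \<open>k / 2 * exp x\<close> once
    \<open>x \<ge> c / (1 - 2 * \<beta>)\<close>; the factor 2 in \<open>le\<close> then leaves
    \<open>k / 4\<close>.\<close>
  define c where "c = 8 * pi * (1 + \<bar>A\<bar>)\<^sup>2 / k"
  define x3 where "x3 = Max {x2, ln R / \<beta> + 1, 0, c / (1 - 2 * \<beta>)}"
  have "k / 4 * exp x \<le> B.\<phi> x" if x: "x3 \<le> x" for x
  proof -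
    have xs: "x2 \<le> x" "ln R / \<beta> < x" "0 \<le> x" "c / (1 - 2 * \<beta>) \<le> x" using x by (auto simp: x3_def)
    have "c \<le> (1 - 2 * \<beta>) * x" using xs(4) \<beta> by (simp add: field_simps)
    also have "\<dots> \<le> exp ((1 - 2 * \<beta>) * x)" using exp_ge_add_one_self[of "(1 - 2 * \<beta>) * x"] by linarith
    finally have c: "c * exp (2 * \<beta> * x) \<le> exp ((1 - 2 * \<beta>) * x) * exp (2 * \<beta> * x)" by simp
    have "1 \<le> exp (\<beta> * x)" using xs \<beta> by simp
    then have "exp (\<beta> * x) + \<bar>A\<bar> \<le> (1 + \<bar>A\<bar>) * exp (\<beta> * x)"
      using mult_left_mono[of 1 "exp (\<beta> * x)" "\<bar>A\<bar>"] by (simp add: distrib_right)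
    then have "(exp (\<beta> * x) + \<bar>A\<bar>)\<^sup>2 \<le> ((1 + \<bar>A\<bar>) * exp (\<beta> * x))\<^sup>2" by (intro power_mono) auto
    also have "\<dots> = (1 + \<bar>A\<bar>)\<^sup>2 * exp (2 * \<beta> * x)"
      by (simp add: power_mult_distrib exp_double[symmetric] mult_ac)
    finally have "4 * pi * (exp (\<beta> * x) + \<bar>A\<bar>)\<^sup>2 \<le> 4 * pi * ((1 + \<bar>A\<bar>)\<^sup>2 * exp (2 * \<beta> * x))" by simp
    also have "\<dots> = k / 2 * (c * exp (2 * \<beta> * x))" using k by (simp add: c_def)
    also have "\<dots> \<le> k / 2 * (exp ((1 - 2 * \<beta>) * x) * exp (2 * \<beta> * x))" using c k by (intro mult_left_mono) auto
    also have "\<dots> = k / 2 * exp x" by (simp add: exp_add[symmetric] algebra_simps)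
    finally show ?thesis using le[OF xs(2)] x2[OF xs(1)] by (simp add: field_simps)
  qed
  then show ?thesis using that[of "k / 4" x3] k by auto
qed

text \<open>The result in the logarithmic coordinate, with \<open>d\<close> the room needed to bound
  \<open>\<phi>'\<close> by \<open>\<phi>\<close>. Nonnegativity of the bound is recorded separately
  because \<open>ennreal\<close> sends negative numbers to 0.\<close>

lemma log_log_maxmod_lower:
  fixes V :: "complex set" and \<psi> :: "real \<Rightarrow> real"
  assumes slit: "\<exists>r1. \<forall>r\<ge>r1. \<not> sphere 0 r \<subseteq> U" and \<beta>: "0 < \<beta>" "\<beta> < 1 / 2"
    and V_def: "V = {z \<in> U. norm (f z) \<ge> exp (norm z powr \<beta>)}"
    and psi_def: "\<And>r. \<psi> r = measure lborel {t \<in> {0..2*pi}. complex_of_real r * cis t \<in> V}"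
    and d: "0 < d"
  obtains C a where "\<And>x. a \<le> x \<Longrightarrow> 0 < \<psi> (exp x)"
    and "\<And>X. a \<le> X \<Longrightarrow> 0 \<le> 2 * ln (ln (maxmod f (exp (X + d)))) + C"
    and "\<And>X. a \<le> X \<Longrightarrow> (\<integral>\<^sup>+x\<in>{a..X}. ennreal (2 * (pi / \<psi> (exp x))) \<partial>lborel)
      \<le> ennreal (2 * ln (ln (maxmod f (exp (X + d)))) + C)"
proof -
  obtain x1 where x1: "\<And>x. x1 \<le> x \<Longrightarrow> \<exists>t\<in>{0..2*pi}. Complex x t \<notin> W"
    using slit_abscissas[OF slit] by blast
  obtain k x3 where k: "0 < k" and x3: "\<And>x. x3 \<le> x \<Longrightarrow> k * exp x \<le> carleman.\<phi> W (v 0 1 \<beta>) x"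
    using power_level_growth[OF slit \<beta>] by blast
  interpret carleman W "v 0 1 \<beta>" "vx 1 \<beta>" vy "vxx 1 \<beta>" vyy "\<lambda>x. 1 * \<beta>\<^sup>2 * exp (\<beta> * x)" "ln R / \<beta>"
    by (rule carleman_power[OF \<beta>(1)])
  have V_sets: "V \<in> sets borel" unfolding V_def by (rule sets_power_level)
  have \<psi>_meas [measurable]: "\<psi> \<in> borel_measurable borel"
    using measurable_arc_measure[OF V_sets, of 0 "2*pi"] by (simp add: psi_def[abs_def])
  have arc_sets: "{t \<in> {0..2*pi}. complex_of_real r * cis t \<in> V} \<in> sets lborel" for r
  proof -
    have "(\<lambda>t. complex_of_real r * cis t) \<in> borel_measurable borel"
      by (intro borel_measurable_continuous_onI continuous_intros)
    then have "{t \<in> space borel. t \<in> {0..2*pi} \<and> complex_of_real r * cis t \<in> V} \<in> sets borel"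
      using V_sets by measurable
    then show ?thesis by simp
  qed
  have arc_finite: "emeasure lborel {t \<in> {0..2*pi}. complex_of_real r * cis t \<in> V} < \<infinity>" for r
    by (rule le_less_trans[OF emeasure_mono[of _ "{0..2*pi}"]]) auto
  have \<psi>_le: "\<psi> r \<le> 2 * pi" for r
  proof -
    have "\<psi> r \<le> measure lborel {0..2*pi}" unfolding psi_def
      by (intro measure_mono_fmeasurable arc_sets) (auto simp: fmeasurable_def)
    then show ?thesis by simp
  qed
  \<comment> \<open>The set where \<open>v > 0\<close> maps into \<open>V\<close>, so
    \<open>pi / \<psi> (exp x)\<close> is an admissible rate.\<close>
  have I_le: "I (\<lambda>_. 1) x \<le> \<psi> (exp x)" if x: "ln R / \<beta> < x" for x
  proof -
    let ?S = "{t \<in> {0..2*pi}. complex_of_real (exp x) * cis t \<in> V}"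
    have "I (\<lambda>_. 1) x \<le> (\<integral>y. indicator ?S y \<partial>lborel)"
      unfolding I_def set_lebesgue_integral_def
    proof (rule integral_mono)
      show "integrable lborel (\<lambda>y. indicat_real {0..2*pi} y *\<^sub>R tr (\<lambda>_. 1) (Complex x y))"
        using tr_set_integrable[OF x, of "\<lambda>_. 1"] by (simp add: set_integrable_def)
      show "integrable lborel (indicat_real ?S)"
        using arc_sets arc_finite by simp
      fix y
      have "Complex x y \<in> P \<Longrightarrow> complex_of_real (exp x) * cis y \<in> V"
      proof -
        assume P: "Complex x y \<in> P"
        have e: "exp (Complex x y) = complex_of_real (exp x) * cis y"
          by (simp add: Complex_eq exp_add exp_of_real cis_conv_exp)
        have "exp (\<beta> * x) < ln (norm (F (Complex x y)))" using P by (simp add: P_def v_def)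
        moreover have "0 < norm (F (Complex x y))" using P P_subset F_nonzero by auto
        ultimately have "exp (exp (\<beta> * x)) \<le> norm (F (Complex x y))"
          by (metis exp_le_cancel_iff exp_ln less_imp_le)
        moreover have "norm (complex_of_real (exp x) * cis y) powr \<beta> = exp (\<beta> * x)"
          by (simp add: norm_mult powr_def)
        ultimately show ?thesis using P P_subset by (auto simp: V_def W_def F_def e)
      qed
      then show "indicat_real {0..2*pi} y *\<^sub>R tr (\<lambda>_. 1) (Complex x y) \<le> indicat_real ?S y"
        by (auto simp: indicator_def tr_def)
    qed
    then show ?thesis by (simp add: psi_def)
  qed
  define \<delta> where "\<delta> = 1 / 2 - \<beta>"
  have \<delta>: "0 < \<delta>" using \<beta> by (simp add: \<delta>_def)
  \<comment> \<open>Twice the factor \<open>2 * \<beta>\<^sup>2\<close> of the error term times the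
    constant from \<open>I_v_le\<close> with \<open>l = exp (- x / 2)\<close>; the doubling offsets
    the division by 2 in \<open>E\<close>.\<close>
  define C1 where "C1 = 4 * \<beta>\<^sup>2 * (1 / 2 + pi / k)"
  have C1: "0 < C1" using \<beta> k by (simp add: C1_def add_pos_pos)
  define \<eta> where "\<eta> x = C1 * exp (- \<delta> * x)" for x
  define H where "H x = - C1 / \<delta> * exp (- \<delta> * x)" for x
  \<comment> \<open>The last entry ensures \<open>\<eta> x \<le> 1/2\<close>.\<close>
  define x4 where "x4 = Max {x1, x3, ln R / \<beta> + 1, 2 * C1 / \<delta>}"
  have x4: "x1 \<le> x" "x3 \<le> x" "ln R / \<beta> < x" "2 * C1 \<le> \<delta> * x" if "x4 \<le> x" for x
    using that \<delta> by (auto simp: x4_def field_simps)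
  have slitP: "\<exists>t\<in>{0..2*pi}. Complex x t \<notin> P" if "x4 \<le> x" for x
    using x1[OF x4(1)[OF that]] P_subset by auto
  have \<eta>: "0 \<le> \<eta> x" "\<eta> x \<le> 1 / 2" if x: "x4 \<le> x" for x
  proof -
    show "0 \<le> \<eta> x" using C1 by (simp add: \<eta>_def)
    have "2 * C1 \<le> exp (\<delta> * x)" using x4(4)[OF x] exp_ge_add_one_self[of "\<delta> * x"] by linarith
    then show "\<eta> x \<le> 1 / 2" by (simp add: \<eta>_def exp_minus field_simps)
  qed
  have E: "2 * (1 * \<beta>\<^sup>2 * exp (\<beta> * x)) * I (v 0 1 \<beta>) x \<le> \<eta> x * \<phi> x / 2" if x: "x4 \<le> x" for x
  proof -
    have "pi / exp (- (x / 2)) = pi / k * exp (- (x / 2)) * (k * exp x)"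
      using k by (simp add: exp_minus field_simps exp_add[symmetric])
    also have "\<dots> \<le> pi / k * exp (- (x / 2)) * \<phi> x"
      using x3[OF x4(2)[OF x]] k by (intro mult_left_mono) auto
    finally have "I (v 0 1 \<beta>) x \<le> exp (- (x / 2)) * (1 / 2 + pi / k) * \<phi> x"
      using I_v_le[OF x4(3)[OF x], of "exp (- (x / 2))"] by (simp add: algebra_simps)
    then have "2 * (1 * \<beta>\<^sup>2 * exp (\<beta> * x)) * I (v 0 1 \<beta>) x
        \<le> 2 * (1 * \<beta>\<^sup>2 * exp (\<beta> * x)) * (exp (- (x / 2)) * (1 / 2 + pi / k) * \<phi> x)"
      by (intro mult_left_mono) auto
    also have "\<dots> = 2 * \<beta>\<^sup>2 * (1 / 2 + pi / k) * (exp (\<beta> * x) * exp (- (x / 2))) * \<phi> x"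
      by (simp add: mult_ac)
    also have "exp (\<beta> * x) * exp (- (x / 2)) = exp (- \<delta> * x)"
      by (simp add: exp_add[symmetric] \<delta>_def algebra_simps)
    also have "2 * \<beta>\<^sup>2 * (1 / 2 + pi / k) * exp (- \<delta> * x) * \<phi> x = \<eta> x * \<phi> x / 2"
      by (simp add: \<eta>_def C1_def)
    finally show ?thesis .
  qed
  have \<phi>pos: "0 < \<phi> x" if "x4 \<le> x" for x
    using x3[OF x4(2)[OF that]] k by (meson less_le_trans mult_pos_pos exp_gt_zero)
  have n2: "0 \<le> \<phi>'' x" if x: "x4 \<le> x" for x
  proof -
    obtain t where "t \<in> {0..2*pi}" "Complex x t \<notin> P" using slitP[OF x] by blast
    from \<phi>''_lower(1)[OF x4(3)[OF x] this E[OF x] \<eta>[OF x]] \<phi>_nonneg[of x] show ?thesis by simp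
  qed
  \<comment> \<open>Exponential growth makes \<open>\<phi> b\<close> exceed \<open>\<phi> x4\<close>
    for some later \<open>b\<close>, and convexity then makes the slope at \<open>b\<close>
    positive.\<close>
  obtain a where a: "x4 \<le> a" "0 < \<phi>' a"
  proof -
    define b where "b = max x4 ((\<phi> x4 + 1) / k)"
    have "(\<phi> x4 + 1) / k \<le> b" by (simp add: b_def)
    also have "b < exp b" using exp_ge_add_one_self[of b] by linarith
    finally have "\<phi> x4 + 1 < k * exp b" using k by (simp add: field_simps)
    also have "\<dots> \<le> \<phi> b" by (rule x3, rule x4) (simp add: b_def)
    finally have "0 < \<phi> b - \<phi> x4" by simp
    also have "\<dots> \<le> (b - x4) * \<phi>' b"
      by (rule \<phi>_increment(2)) (use x4(3)[of x4] n2 in \<open>auto simp: b_def\<close>)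
    finally have "0 < (b - x4) * \<phi>' b" .
    moreover have "0 \<le> b - x4" by (simp add: b_def)
    ultimately have "0 < \<phi>' b" by (simp add: zero_less_mult_iff)
    then show ?thesis using that[of b] by (simp add: b_def)
  qed
  have \<psi>pos: "0 < \<psi> (exp x)" if x: "a \<le> x" for x
  proof -
    have x': "x4 \<le> x" using x a by simp
    obtain t where "t \<in> {0..2*pi}" "Complex x t \<notin> P" using slitP[OF x'] by blast
    from I_one_pos[OF x4(3)[OF x'] this \<phi>pos[OF x']] I_le[OF x4(3)[OF x']] show ?thesis by simp
  qed
  define C where "C = ln (2 * pi) - ln d - ln (\<phi>' a) + C1 / \<delta> * exp (- \<delta> * a)"
  have core: "0 \<le> ln (\<phi>' X) - ln (\<phi>' a) + (H X - H a)"
    "ln (\<phi>' X) - ln (\<phi>' a) + (H X - H a) \<le> 2 * ln (ln (maxmod f (exp (X + d)))) + C"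
    if X: "a \<le> X" for X
  proof -
    have mono: "\<phi>' a \<le> \<phi>' X"
      by (rule \<phi>'_mono) (use X a x4(3)[OF a(1)] n2 in auto)
    have "exp (- \<delta> * X) \<le> exp (- \<delta> * a)" using X \<delta> by simp
    then have "C1 / \<delta> * exp (- \<delta> * X) \<le> C1 / \<delta> * exp (- \<delta> * a)" using C1 \<delta> by (intro mult_left_mono) auto
    then have "0 \<le> H X - H a" by (simp add: H_def)
    then show "0 \<le> ln (\<phi>' X) - ln (\<phi>' a) + (H X - H a)" using mono a(2) by simp
    have Xd: "ln R / \<beta> < X + d" "x4 \<le> X + d" using X a x4(3)[OF a(1)] d by auto
    \<comment> \<open>Convexity bounds the slope at \<open>X\<close> by the increment over a step of
      length \<open>d\<close>; this is where the larger radius in \<open>maxmod\<close> comes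
      from.\<close>
    have "((X + d) - X) * \<phi>' X \<le> \<phi> (X + d) - \<phi> X"
      by (rule \<phi>_increment(1)) (use X a x4(3)[OF a(1)] d n2 in auto)
    then have 1: "d * \<phi>' X \<le> \<phi> (X + d)" using \<phi>_nonneg[of X] by simp
    let ?M = "maxmod f (exp (X + d))"
    have lnF: "v 0 1 \<beta> z \<le> ln ?M \<and> 0 < ln ?M" if z: "z \<in> P" "Re z = X + d" for z
    proof -
      have "0 < norm (F z)" using z P_subset F_nonzero by auto
      moreover have "norm (F z) \<le> ?M" using norm_F_le_maxmod[of z] z by simp
      ultimately have "ln (norm (F z)) \<le> ln ?M" by (subst ln_le_cancel_iff) linarith+
      moreover have "0 < v 0 1 \<beta> z" using z by (simp add: P_def)
      moreover have "v 0 1 \<beta> z < ln (norm (F z))" by (simp add: v_def)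
      ultimately show ?thesis by linarith
    qed
    have 2: "\<phi> (X + d) \<le> 2 * pi * (ln ?M)\<^sup>2" by (rule \<phi>_le[OF Xd(1)]) (use lnF in auto)
    \<comment> \<open>A point of \<open>P\<close> on this line yields \<open>ln ?M > 0\<close>, so
      that the iterated logarithm is genuine.\<close>
    have "\<exists>z\<in>P. Re z = X + d"
    proof (rule ccontr)
      assume "\<not> ?thesis"
      then have "\<phi> (X + d) \<le> 2 * pi * 0\<^sup>2" by (intro \<phi>_le Xd) auto
      then show False using \<phi>pos[OF Xd(2)] by simp
    qed
    then have M: "0 < ln ?M" using lnF by blast
    have K: "0 < \<phi>' X" using mono a by simp
    have "0 < d * \<phi>' X" using K d by simp
    then have "ln (d * \<phi>' X) \<le> ln (2 * pi * (ln ?M)\<^sup>2)"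
      using 1 2 by (subst ln_le_cancel_iff) linarith+
    also have "\<dots> = ln (2 * pi) + 2 * ln (ln ?M)" using M by (simp add: ln_mult ln_realpow)
    also have "ln (d * \<phi>' X) = ln d + ln (\<phi>' X)" using K d by (simp add: ln_mult)
    finally have "ln (\<phi>' X) \<le> ln (2 * pi) - ln d + 2 * ln (ln ?M)" by simp
    moreover have "H X - H a \<le> C1 / \<delta> * exp (- \<delta> * a)" using C1 \<delta> by (simp add: H_def)
    ultimately show "ln (\<phi>' X) - ln (\<phi>' a) + (H X - H a) \<le> 2 * ln (ln ?M) + C"
      by (simp add: C_def)
  qed
  have int: "(\<integral>\<^sup>+x\<in>{a..X}. ennreal (2 * (pi / \<psi> (exp x))) \<partial>lborel)
      \<le> ennreal (2 * ln (ln (maxmod f (exp (X + d)))) + C)" if X: "a \<le> X" for X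
  proof -
    have "(\<integral>\<^sup>+x\<in>{a..X}. ennreal (2 * (pi / \<psi> (exp x))) \<partial>lborel) \<le> ennreal (ln (\<phi>' X) - ln (\<phi>' a) + (H X - H a))"
    proof (rule log_growth[where \<eta> = \<eta>])
      show "set_integrable lborel {a..X} \<eta>"
        unfolding \<eta>_def[abs_def] by (rule integral_exp_decay(1)[OF \<delta> X])
      show "(LINT x:{s..t}|lborel. \<eta> x) = H t - H s" if "s \<le> t" for s t
        unfolding \<eta>_def H_def by (rule integral_exp_decay(2)[OF \<delta> that])
      fix x assume "x \<in> {a..X}"
      then have x: "a \<le> x" "x4 \<le> x" using a by auto
      show "1 / 2 \<le> pi / \<psi> (exp x)" using \<psi>pos[OF x(1)] \<psi>_le[of "exp x"] by (simp add: field_simps)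
      show "pi / \<psi> (exp x) * I (\<lambda>_. 1) x \<le> pi"
        using \<psi>pos[OF x(1)] I_le[OF x4(3)[OF x(2)]] by (simp add: field_simps)
      show "2 * (1 * \<beta>\<^sup>2 * exp (\<beta> * x)) * I (v 0 1 \<beta>) x \<le> \<eta> x * \<phi> x / 2" by (rule E[OF x(2)])
      show "0 \<le> \<eta> x" "\<eta> x \<le> 1 / 2" using \<eta>[OF x(2)] by auto
      show "\<exists>t\<in>{0..2*pi}. Complex x t \<notin> P" by (rule slitP[OF x(2)])
    qed (use a X x4(3)[OF a(1)] in auto)
    also have "\<dots> \<le> ennreal (2 * ln (ln (maxmod f (exp (X + d)))) + C)"
      by (intro ennreal_leI core(2) X)
    finally show ?thesis .
  qed
  show ?thesis
  proof (rule that[OF \<psi>pos _ int])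
    show "0 \<le> 2 * ln (ln (maxmod f (exp (X + d)))) + C" if "a \<le> X" for X
      using core[OF that] by linarith
  qed
qed

end

text \<open>The integral is taken in the extended nonnegative reals, with the value infinity where
  \<open>\<psi>\<close> vanishes, so the inequality also asserts that the integral is
  finite.\<close>

theorem theorem1p2:
  fixes f :: "complex \<Rightarrow> complex" and R \<beta> :: real and U V :: "complex set"
    and \<psi> :: "real \<Rightarrow> real"
  assumes entire: "f holomorphic_on UNIV"
    and R_pos: "R > 0"
    and U_comp: "U \<in> components {z. norm (f z) > R}"
    and circles: "\<exists>r1. \<forall>r\<ge>r1. \<not> sphere 0 r \<subseteq> U"
    and beta: "0 < \<beta>" "\<beta> < 1/2"
    and V_def: "V = {z \<in> U. norm (f z) \<ge> exp (norm z powr \<beta>)}"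
    and psi_def: "\<And>r. \<psi> r = measure lborel {t \<in> {0..2*pi}. complex_of_real r * cis t \<in> V}"
  shows "\<forall>\<kappa>. 0 < \<kappa> \<and> \<kappa> < 1 \<longrightarrow>
           (\<exists>C r0. r0 > 0 \<and> (\<forall>r \<ge> r0 / \<kappa>.
              ereal (ln (ln (maxmod f r))) \<ge>
                ereal pi * enn2ereal (set_nn_integral lborel {r0..\<kappa> * r}
                   (\<lambda>t. if \<psi> t = 0 then \<infinity> else ennreal (1 / (t * \<psi> t))))
                - ereal C))"
proof (intro allI impI, elim conjE)
  fix \<kappa> :: real assume \<kappa>: "0 < \<kappa>" "\<kappa> < 1"
  interpret tract f R U by unfold_locales fact+
  \<comment> \<open>With \<open>X = ln (\<kappa> * r)\<close> the shift by
    \<open>- ln \<kappa>\<close> gives \<open>exp (X - ln \<kappa>) = r\<close>.\<close>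
  have d: "0 < - ln \<kappa>" using \<kappa> by simp
  obtain C a where \<psi>pos: "\<And>x. a \<le> x \<Longrightarrow> 0 < \<psi> (exp x)"
    and C: "\<And>X. a \<le> X \<Longrightarrow> 0 \<le> 2 * ln (ln (maxmod f (exp (X + - ln \<kappa>)))) + C"
      "\<And>X. a \<le> X \<Longrightarrow> (\<integral>\<^sup>+x\<in>{a..X}. ennreal (2 * (pi / \<psi> (exp x))) \<partial>lborel)
      \<le> ennreal (2 * ln (ln (maxmod f (exp (X + - ln \<kappa>)))) + C)"
    by (rule log_log_maxmod_lower[OF circles beta V_def psi_def d]) (blast intro: that)
  have V_sets: "V \<in> sets borel" unfolding V_def by (rule sets_power_level)
  have \<psi>_meas [measurable]: "\<psi> \<in> borel_measurable borel"
    using measurable_arc_measure[OF V_sets, of 0 "2*pi"] by (simp add: psi_def[abs_def])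
  let ?g = "\<lambda>t. if \<psi> t = 0 then \<infinity> else ennreal (1 / (t * \<psi> t))"
  show "\<exists>C r0. r0 > 0 \<and> (\<forall>r \<ge> r0 / \<kappa>. ereal (ln (ln (maxmod f r))) \<ge>
      ereal pi * enn2ereal (set_nn_integral lborel {r0..\<kappa> * r} ?g) - ereal C)"
  proof (intro exI conjI allI impI)
    show "exp a > 0" by simp
    fix r assume r: "exp a / \<kappa> \<le> r"
    then have er: "exp a \<le> \<kappa> * r" using \<kappa> by (simp add: field_simps)
    have rpos: "0 < r" using r \<kappa> by (meson divide_pos_pos exp_gt_zero less_le_trans)
    define X where "X = ln (\<kappa> * r)"
    have eX: "exp X = \<kappa> * r" using \<kappa> rpos by (simp add: X_def)
    have X: "a \<le> X" using er eX by (metis exp_le_cancel_iff)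
    have Xd: "exp (X + - ln \<kappa>) = r" using \<kappa> eX by (simp add: exp_diff)
    let ?L = "ln (ln (maxmod f r))"
    define N where "N = set_nn_integral lborel {exp a..\<kappa> * r} ?g"
    \<comment> \<open>On the range of integration \<open>\<psi>\<close> is positive, so the infinite
      branch never occurs. The substitution \<open>t = exp x\<close> that follows turns
      \<open>dt / (t * \<psi> t)\<close> into \<open>dx / \<psi> (exp x)\<close>.\<close>
    have "N = (\<integral>\<^sup>+t. ennreal (1 / (t * \<psi> t) * indicator {exp a..exp X} t) \<partial>lborel)"
      unfolding N_def eX
    proof (rule nn_integral_cong)
      fix t
      show "?g t * indicator {exp a..\<kappa> * r} t = ennreal (1 / (t * \<psi> t) * indicator {exp a..\<kappa> * r} t)"
      proof (cases "t \<in> {exp a..\<kappa> * r}")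
        case True
        then have "0 < t" by (meson atLeastAtMost_iff exp_gt_zero less_le_trans)
        then have "a \<le> ln t" "exp (ln t) = t" using True by (auto simp: ln_ge_iff)
        with \<psi>pos[of "ln t"] True show ?thesis by simp
      qed auto
    qed
    also have "\<dots> = (\<integral>\<^sup>+x. ennreal (1 / (exp x * \<psi> (exp x)) * exp x * indicator {a..X} x) \<partial>lborel)"
      by (rule nn_integral_substitution)
        (use X in \<open>auto intro!: DERIV_exp continuous_intros simp: set_borel_measurable_def\<close>)
    also have "\<dots> = (\<integral>\<^sup>+x. ennreal (1 / (2 * pi)) * (ennreal (2 * (pi / \<psi> (exp x))) * indicator {a..X} x) \<partial>lborel)"
    proof (rule nn_integral_cong)
      fix x
      show "ennreal (1 / (exp x * \<psi> (exp x)) * exp x * indicator {a..X} x)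
          = ennreal (1 / (2 * pi)) * (ennreal (2 * (pi / \<psi> (exp x))) * indicator {a..X} x)"
        using \<psi>pos[of x] by (cases "x \<in> {a..X}") (auto simp: ennreal_mult'[symmetric])
    qed
    also have "\<dots> = ennreal (1 / (2 * pi)) * (\<integral>\<^sup>+x\<in>{a..X}. ennreal (2 * (pi / \<psi> (exp x))) \<partial>lborel)"
      by (rule nn_integral_cmult) measurable
    also have "\<dots> \<le> ennreal (1 / (2 * pi)) * ennreal (2 * ?L + C)"
      using C(2)[OF X] unfolding Xd by (intro mult_left_mono) auto
    also have "\<dots> = ennreal ((2 * ?L + C) / (2 * pi))"
      by (subst ennreal_mult'[symmetric]) auto
    finally have N: "N \<le> ennreal ((2 * ?L + C) / (2 * pi))" .
    have "enn2ereal N \<le> enn2ereal (ennreal ((2 * ?L + C) / (2 * pi)))"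
      using N by (simp add: less_eq_ennreal.rep_eq)
    also have "\<dots> = ereal ((2 * ?L + C) / (2 * pi))"
      using C(1)[OF X] unfolding Xd by (intro enn2ereal_ennreal) simp
    finally have "ereal pi * enn2ereal N \<le> ereal pi * ereal ((2 * ?L + C) / (2 * pi))"
      by (intro ereal_mult_left_mono) auto
    also have "\<dots> = ereal (?L + C / 2)" by (simp add: field_simps)
    finally have "ereal pi * enn2ereal N \<le> ereal ?L + ereal (C / 2)" by simp
    then have "ereal pi * enn2ereal N - ereal (C / 2) \<le> ereal ?L"
      by (subst ereal_minus_le_iff) (auto simp: add.commute)
    then show "ereal ?L \<ge> ereal pi * enn2ereal (set_nn_integral lborel {exp a..\<kappa> * r} ?g) - ereal (C / 2)"
      by (simp add: N_def)
  qed
qed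

end
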